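(* Each graph in the family $\mathcal F_3$ belongs to ${\bf Forb}(\Gamma_{\leq 3})$.
   Context: All graphs are finite. For a graph $G$ with vertex set $V$ and indeterminates $X_G=\{x_u : u\in V\}$, the generalized Laplacian matrix $L(G,X_G)$ is the matrix indexed by $V$ with $L(G,X_G)_{uu}=x_u$ and $L(G,X_G)_{uv}=-m_{uv}$ for $u\neq v$, where $m_{uv}$ is the number of edges between $u$ and $v$. For $1\leq i\leq |V|$, the $i$-th critical ideal $I_i(G,X_G)\subseteq\mathbb Z[X_G]$ is the ideal generated by the determinants of all $i\times i$ submatrices of $L(G,X_G)$. It is trivial if it equals $\langle 1\rangle$. The algebraic co-rank $\gamma(G)$ is the number of trivial critical ideals of $G$. $\Gamma_{\leq k}$ is the set of simple connected graphs $G$ with $\gamma(G)\leq k$. A graph $G$ is forbidden for $\Gamma_{\leq k}$ if $\gamma(G)\geq k+1$, and ${\bf Forb}(\Gamma_{\leq k})$ is the set of forbidden graphs for $\Gamma_{\leq k}$ that are minimal under induced subgraphs; equivalently, the set of graphs $G$ with $\gamma(G)\geq k+1$ and $\gamma(G-v)\leq k$ for all $v\in V(G)$. Substitution: given a simple graph $H$ and, for each vertex $u$ of $H$, a positive integer $n_u$ and a type (clique or stable set), one forms a new simple graph by replacing each $u$ by a set $V_u$ of $n_u$ vertices, which is a clique or a stable set (no edges inside) according to its type, and, for $u\ne v$, joining every vertex of $V_u$ to every vertex of $V_v$ if $uv\in E(H)$, and to none otherwise. The family $\mathcal F_3$ consists of the 49 graphs listed below. Each is described by an underlying graph, given by its edge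 list ($ij$ denotes the edge between vertices $i$ and $j$; the vertices are the digits that appear), together with a set $W$ of vertices to be replaced by a stable set of cardinality $2$ and a set $B$ of vertices to be replaced by a clique of cardinality $2$ (all other vertices remain single; omitted $W$ or $B$ are empty). $P_5$: 12,23,34,45. $G_{6,1}$: 15,46,56; $W=\{1,4\}$. $G_{6,2}$: 15,16,25,46,56; $W=\{4\}$. $G_{6,3}$: 15,16,46; $W=\{1,4\}$. $G_{6,4}$: 15,16,46,56; $W=\{1,4\}$. $G_{6,5}$: 15,16,35,46,56; $W=\{1\}$. $G_{6,6}$: 16,25,26,36; $B=\{1\}$. $G_{6,7}$: 14,16,25,26,56; $W=\{2\}$. $G_{6,8}$: 14,15,16,25,36,56. $G_{6,9}$: 14,15,16,25,26,36. $G_{6,10}$: 14,15,16,25,26,36,56. $G_{6,11}$: 14,15,16,25,26,36,46. $G_{6,12}$: 14,15,16,25,26,36,46,56. $G_{6,13}$: 15,16,25,26,36,56; $B=\{1\}$. $G_{6,14}$: 14,15,16,25,26,35,46,56. $G_{6,15}$: 14,15,16,25,26,46; $W=\{2\}$. $G_{6,16}$: 14,15,16,25,26,46,56; $W=\{2\}$. $G_{6,17}$: 14,15,16,24,26,35,36,45,46. $G_{6,18}$: 14,15,16,24,26,35,36,45,46,56. $G_{6,19}$: 15,16,25,36,56; $B=\{5\}$. $G_{6,20}$: 15,16,24,25,46,56; $B=\{1\}$. $G_{6,21}$: 13,15,16,24,25,26,35,46. $G_{6,22}$: 13,15,16,24,25,26,35,46,56. $G_{6,23}$: 14,15,16,25,26,46,56;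 $B=\{1\}$. $G_{6,24}$: 13,14,15,16,24,25,26,35,46,56. $G_{6,25}$: 13,14,15,16,24,25,26,35,36,46. $G_{6,26}$: 13,14,15,16,24,25,26,35,36,46,56. $G_{6,27}$: 13,14,15,24,25,35,45; $B=\{5\}$. $G_{7,1}$: 17,27,37; $W=\{3\}$, $B=\{1,2\}$. $G_{7,2}$: 16,17,26,27,47; $W=\{2\}$, $B=\{1\}$. $G_{7,3}$: 24,26,27,37,46,47,67; $W=\{2,4\}$. $G_{7,4}$: 15,16,17,37,56,57; $W=\{1\}$, $B=\{5\}$. $G_{7,5}$: 24,25,26,27,36,37,45,46,47,57; $W=\{2\}$. $G_{7,6}$: 14,16,36,46; $W=\{1\}$, $B=\{4,6\}$. $G_{7,7}$: 14,15,24,25,35; $B=\{1,4\}$. $G_{7,8}$: 24,25,27,35,47,57; $W=\{2\}$, $B=\{4\}$. $G_{7,9}$: 24,25,26,35,36; $W=\{2\}$, $B=\{5\}$. $G_{7,10}$: 14,15,17,35,37,57; $W=\{1,5\}$. $G_{7,11}$: 14,16,17,36,37,46,47; $W=\{1\}$, $B=\{7\}$. $G_{7,12}$: 24,25,27,35,37,45,47,57; $W=\{2,5\}$. $G_{7,13}$: 15,16,17,35,36,57; $W=\{1,5\}$. $G_{7,14}$: 15,17,27; $B=\{2,5,7\}$. $G_{7,15}$: 14,15,17,25,27,47; $B=\{1,7\}$. $G_{7,16}$: 13,14,17,23,24,27,37,47; $B=\{1,3\}$. $G_{7,17}$: 13,14,16,23,24,26,36,46; $B=\{3,6\}$. $G_{8,1}$: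 36,37,46,47,56,57; $B=\{4,5,6\}$. $G_{8,2}$: 16,18,36,38,56,58,68; $W=\{6\}$, $B=\{1,5\}$. $G_{8,3}$: 35,37,45,47; $W=\{3,7\}$, $B=\{4,5\}$. $G_{8,4}$: 13,15,17,35,37,57; $W=\{1,3,5\}$, $B=\{7\}$. *)

theory Defs
  imports
    "Jordan_Normal_Form.Determinant"
    "HOL-Algebra.Ideal"
    "HOL-Library.Poly_Mapping"
begin

section \<open>Graphs\<close>

text \<open>Finite undirected graphs without loops; parallel edges are allowed, and
  \<open>edge_mult G u v\<close> is the number $m_{uv}$ of edges between \<open>u\<close> and \<open>v\<close>.
  It vanishes outside the vertex set, so that equality of records is equality of graphs.\<close>

record 'a mgraph =
  verts :: "'a set"
  edge_mult :: "'a \<Rightarrow> 'a \<Rightarrow> nat"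

definition is_graph :: "'a mgraph \<Rightarrow> bool" where
  "is_graph G \<longleftrightarrow> finite (verts G) \<and>
     (\<forall>u v. edge_mult G u v = edge_mult G v u) \<and>
     (\<forall>u. edge_mult G u u = 0) \<and>
     (\<forall>u v. edge_mult G u v > 0 \<longrightarrow> u \<in> verts G \<and> v \<in> verts G)"

definition induced_subgraph :: "'a mgraph \<Rightarrow> 'a set \<Rightarrow> 'a mgraph" where
  "induced_subgraph G U =
     \<lparr>verts = U, edge_mult = (\<lambda>u v. if u \<in> U \<and> v \<in> U then edge_mult G u v else 0)\<rparr>"

section \<open>Critical ideals and the algebraic co-rank\<close>

text \<open>A monomial is its finitely supported exponent function and a polynomial is the finitely
  supported function giving the coefficients of the monomials; the type \<open>'a zpoly\<close> is the
  polynomial ring over the integers with one indeterminate for each element of \<open>'a\<close>.\<close>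

type_synonym 'a zpoly = "('a \<Rightarrow>\<^sub>0 nat) \<Rightarrow>\<^sub>0 int"

definition indet :: "'a \<Rightarrow> 'a zpoly" where
  "indet u = Poly_Mapping.single (Poly_Mapping.single u 1) 1"

definition zpoly_ring :: "'a set \<Rightarrow> 'a zpoly ring" where
  "zpoly_ring V =
     \<lparr>carrier = {p. \<forall>m \<in> Poly_Mapping.keys p. Poly_Mapping.keys m \<subseteq> V},
      mult = (*), one = 1, zero = 0, add = (+)\<rparr>"

definition laplacian :: "'a mgraph \<Rightarrow> 'a \<Rightarrow> 'a \<Rightarrow> 'a zpoly" where
  "laplacian G u v = (if u = v then indet u else - of_nat (edge_mult G u v))"

text \<open>The vertices carry no order, so the rows and the columns of a submatrix are listed in every
  possible order. Reordering changes a determinant only by a sign, hence not the ideal.\<close>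

definition laplacian_minors :: "'a mgraph \<Rightarrow> nat \<Rightarrow> 'a zpoly set" where
  "laplacian_minors G i =
     {det (mat i i (\<lambda>(a, b). laplacian G (rs ! a) (cs ! b))) | rs cs.
        distinct rs \<and> length rs = i \<and> set rs \<subseteq> verts G \<and>
        distinct cs \<and> length cs = i \<and> set cs \<subseteq> verts G}"

definition critical_ideal :: "'a mgraph \<Rightarrow> nat \<Rightarrow> 'a zpoly set" where
  "critical_ideal G i = Idl\<^bsub>zpoly_ring (verts G)\<^esub> (laplacian_minors G i)"

definition trivial_critical_ideal :: "'a mgraph \<Rightarrow> nat \<Rightarrow> bool" where
  "trivial_critical_ideal G i \<longleftrightarrow> critical_ideal G i = Idl\<^bsub>zpoly_ring (verts G)\<^esub> {1}"

definition algebraic_corank :: "'a mgraph \<Rightarrow> nat" where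
  "algebraic_corank G = card {i \<in> {1..card (verts G)}. trivial_critical_ideal G i}"

definition forbidden :: "nat \<Rightarrow> 'a mgraph \<Rightarrow> bool" where
  "forbidden k G \<longleftrightarrow> algebraic_corank G \<ge> k + 1"

text \<open>\<open>Forb_Gamma k\<close> is $\mathbf{Forb}(\Gamma_{\leq k})$.\<close>

definition Forb_Gamma :: "nat \<Rightarrow> 'a mgraph set" where
  "Forb_Gamma k = {G. is_graph G \<and> forbidden k G \<and>
     (\<forall>U. U \<subset> verts G \<longrightarrow> \<not> forbidden k (induced_subgraph G U))}"

lemma cring_zpoly_ring: "cring (zpoly_ring V)"
proof (rule cringI)
  show "abelian_group (zpoly_ring V)"
  proof (rule abelian_groupI)
    fix p :: "'a zpoly" assume p: "p \<in> carrier (zpoly_ring V)"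
    then have "- p \<in> carrier (zpoly_ring V)"
      by (simp add: zpoly_ring_def)
    then show "\<exists>q \<in> carrier (zpoly_ring V). q \<oplus>\<^bsub>zpoly_ring V\<^esub> p = \<zero>\<^bsub>zpoly_ring V\<^esub>"
      by (intro bexI[of _ "- p"]) (simp_all add: zpoly_ring_def)
  qed (use Poly_Mapping.keys_add in \<open>fastforce simp: zpoly_ring_def add_ac\<close>)+
  have mult_closed: "p * q \<in> carrier (zpoly_ring V)"
    if p: "p \<in> carrier (zpoly_ring V)" and q: "q \<in> carrier (zpoly_ring V)" for p q :: "'a zpoly"
  proof -
    have "Poly_Mapping.keys m \<subseteq> V" if m: "m \<in> Poly_Mapping.keys (p * q)" for m
    proof -
      obtain a b where "m = a + b" "a \<in> Poly_Mapping.keys p" "b \<in> Poly_Mapping.keys q"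
        using keys_mult[of p q] m by blast
      then show ?thesis
        using p q Poly_Mapping.keys_add[of a b] unfolding zpoly_ring_def by simp blast
    qed
    then show ?thesis by (simp add: zpoly_ring_def)
  qed
  show "Group.comm_monoid (zpoly_ring V)"
  proof (rule Group.comm_monoidI)
    fix p q :: "'a zpoly"
    assume "p \<in> carrier (zpoly_ring V)" "q \<in> carrier (zpoly_ring V)"
    then have "p * q \<in> carrier (zpoly_ring V)"
      by (rule mult_closed)
    then show "p \<otimes>\<^bsub>zpoly_ring V\<^esub> q \<in> carrier (zpoly_ring V)"
      by (simp add: zpoly_ring_def)
  qed (simp_all add: zpoly_ring_def mult_ac)
qed (simp add: zpoly_ring_def distrib_right)

section \<open>Substitution of cliques and stable sets\<close>

text \<open>The vertex \<open>u\<close> is replaced by the \<open>n u\<close> vertices \<open>(u, 0), \<dots>, (u, n u - 1)\<close>, which form a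
  clique if \<open>clique u\<close> holds and a stable set otherwise.\<close>

definition substitution :: "'a mgraph \<Rightarrow> ('a \<Rightarrow> nat) \<Rightarrow> ('a \<Rightarrow> bool) \<Rightarrow> ('a \<times> nat) mgraph" where
  "substitution H n clique =
     (let V = (SIGMA u : verts H. {..<n u}) in
      \<lparr>verts = V,
       edge_mult = (\<lambda>(u, i) (v, j).
         if (u, i) \<in> V \<and> (v, j) \<in> V
         then if u = v then of_bool (i \<noteq> j \<and> clique u) else edge_mult H u v
         else 0)\<rparr>)"

section \<open>The family\<close>

definition edge_list_graph :: "(nat \<times> nat) list \<Rightarrow> nat mgraph" where
  "edge_list_graph es =
     \<lparr>verts = fst ` set es \<union> snd ` set es,
      edge_mult = (\<lambda>u v. of_bool ((u, v) \<in> set es \<or> (v, u) \<in> set es))\<rparr>"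

text \<open>An entry \<open>(es, W, B)\<close> stands for the graph with edges \<open>es\<close> in which the vertices in \<open>W\<close> are
  replaced by stable sets and those in \<open>B\<close> by cliques, all of cardinality 2.\<close>

definition entry_graph :: "(nat \<times> nat) list \<times> nat list \<times> nat list \<Rightarrow> (nat \<times> nat) mgraph" where
  "entry_graph = (\<lambda>(es, W, B).
     substitution (edge_list_graph es)
       (\<lambda>u. if u \<in> set W \<union> set B then 2 else 1) (\<lambda>u. u \<in> set B))"

text \<open>The order is $P_5$, $G_{6,1}, \dots, G_{6,27}$, $G_{7,1}, \dots, G_{7,17}$,
  $G_{8,1}, \dots, G_{8,4}$.\<close>

definition F3_entries :: "((nat \<times> nat) list \<times> nat list \<times> nat list) list" where
  "F3_entries = [
    ([(1,2), (2,3), (3,4), (4,5)], [], []),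
    ([(1,5), (4,6), (5,6)], [1,4], []),
    ([(1,5), (1,6), (2,5), (4,6), (5,6)], [4], []),
    ([(1,5), (1,6), (4,6)], [1,4], []),
    ([(1,5), (1,6), (4,6), (5,6)], [1,4], []),
    ([(1,5), (1,6), (3,5), (4,6), (5,6)], [1], []),
    ([(1,6), (2,5), (2,6), (3,6)], [], [1]),
    ([(1,4), (1,6), (2,5), (2,6), (5,6)], [2], []),
    ([(1,4), (1,5), (1,6), (2,5), (3,6), (5,6)], [], []),
    ([(1,4), (1,5), (1,6), (2,5), (2,6), (3,6)], [], []),
    ([(1,4), (1,5), (1,6), (2,5), (2,6), (3,6), (5,6)], [], []),
    ([(1,4), (1,5), (1,6), (2,5), (2,6), (3,6), (4,6)], [], []),
    ([(1,4), (1,5), (1,6), (2,5), (2,6), (3,6), (4,6), (5,6)], [], []),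
    ([(1,5), (1,6), (2,5), (2,6), (3,6), (5,6)], [], [1]),
    ([(1,4), (1,5), (1,6), (2,5), (2,6), (3,5), (4,6), (5,6)], [], []),
    ([(1,4), (1,5), (1,6), (2,5), (2,6), (4,6)], [2], []),
    ([(1,4), (1,5), (1,6), (2,5), (2,6), (4,6), (5,6)], [2], []),
    ([(1,4), (1,5), (1,6), (2,4), (2,6), (3,5), (3,6), (4,5), (4,6)], [], []),
    ([(1,4), (1,5), (1,6), (2,4), (2,6), (3,5), (3,6), (4,5), (4,6), (5,6)], [], []),
    ([(1,5), (1,6), (2,5), (3,6), (5,6)], [], [5]),
    ([(1,5), (1,6), (2,4), (2,5), (4,6), (5,6)], [], [1]),
    ([(1,3), (1,5), (1,6), (2,4), (2,5), (2,6), (3,5), (4,6)], [], []),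
    ([(1,3), (1,5), (1,6), (2,4), (2,5), (2,6), (3,5), (4,6), (5,6)], [], []),
    ([(1,4), (1,5), (1,6), (2,5), (2,6), (4,6), (5,6)], [], [1]),
    ([(1,3), (1,4), (1,5), (1,6), (2,4), (2,5), (2,6), (3,5), (4,6), (5,6)], [], []),
    ([(1,3), (1,4), (1,5), (1,6), (2,4), (2,5), (2,6), (3,5), (3,6), (4,6)], [], []),
    ([(1,3), (1,4), (1,5), (1,6), (2,4), (2,5), (2,6), (3,5), (3,6), (4,6), (5,6)], [], []),
    ([(1,3), (1,4), (1,5), (2,4), (2,5), (3,5), (4,5)], [], [5]),
    ([(1,7), (2,7), (3,7)], [3], [1,2]),
    ([(1,6), (1,7), (2,6), (2,7), (4,7)], [2], [1]),
    ([(2,4), (2,6), (2,7), (3,7), (4,6), (4,7), (6,7)], [2,4], []),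
    ([(1,5), (1,6), (1,7), (3,7), (5,6), (5,7)], [1], [5]),
    ([(2,4), (2,5), (2,6), (2,7), (3,6), (3,7), (4,5), (4,6), (4,7), (5,7)], [2], []),
    ([(1,4), (1,6), (3,6), (4,6)], [1], [4,6]),
    ([(1,4), (1,5), (2,4), (2,5), (3,5)], [], [1,4]),
    ([(2,4), (2,5), (2,7), (3,5), (4,7), (5,7)], [2], [4]),
    ([(2,4), (2,5), (2,6), (3,5), (3,6)], [2], [5]),
    ([(1,4), (1,5), (1,7), (3,5), (3,7), (5,7)], [1,5], []),
    ([(1,4), (1,6), (1,7), (3,6), (3,7), (4,6), (4,7)], [1], [7]),
    ([(2,4), (2,5), (2,7), (3,5), (3,7), (4,5), (4,7), (5,7)], [2,5], []),
    ([(1,5), (1,6), (1,7), (3,5), (3,6), (5,7)], [1,5], []),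
    ([(1,5), (1,7), (2,7)], [], [2,5,7]),
    ([(1,4), (1,5), (1,7), (2,5), (2,7), (4,7)], [], [1,7]),
    ([(1,3), (1,4), (1,7), (2,3), (2,4), (2,7), (3,7), (4,7)], [], [1,3]),
    ([(1,3), (1,4), (1,6), (2,3), (2,4), (2,6), (3,6), (4,6)], [], [3,6]),
    ([(3,6), (3,7), (4,6), (4,7), (5,6), (5,7)], [], [4,5,6]),
    ([(1,6), (1,8), (3,6), (3,8), (5,6), (5,8), (6,8)], [6], [1,5]),
    ([(3,5), (3,7), (4,5), (4,7)], [3,7], [4,5]),
    ([(1,3), (1,5), (1,7), (3,5), (3,7), (5,7)], [1,3,5], [7])]"

definition F3 :: "(nat \<times> nat) mgraph set" where
  "F3 = entry_graph ` set F3_entries"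

end

theory Submission
  imports Defs "HOL-Library.Numeral_Type"
begin

text \<open>
  Every graph \<open>G\<close> of the family has a $4 \times 4$ minor equal to $1$ or $-1$, so its fourth
  critical ideal is trivial, and so are the first three because the ideals decrease. Conversely,
  over the field with three elements every \<open>G - x\<close> is represented by vectors of dimension 3, in
  the sense that $m_{uv} = \langle w_u, w_v \rangle$ for \<open>u \<noteq> v\<close>. At the point
  $x_u = -\langle w_u, w_u \rangle$ the generalized Laplacian of \<open>G - x\<close> then has rank at most 3,
  so all its minors of size at least 4 vanish there and generate a proper ideal; the same point
  serves all induced subgraphs of \<open>G - x\<close>. The minors and the vectors were found by a search.
\<close>

section \<open>Minors indexed by lists\<close>

text \<open>The entry function and the ring are left open, so that the polynomial Laplacian, its
  values at a point and a factored matrix share one notion. Lists allow induction on the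
  rows.\<close>

definition list_minor :: "('a \<Rightarrow> 'b \<Rightarrow> 'r :: comm_ring_1) \<Rightarrow> 'a list \<Rightarrow> 'b list \<Rightarrow> 'r" where
  "list_minor f rs cs = det (mat (length rs) (length rs) (\<lambda>(a, b). f (rs ! a) (cs ! b)))"

definition drop_nth :: "nat \<Rightarrow> 'a list \<Rightarrow> 'a list" where
  "drop_nth j xs = take j xs @ drop (Suc j) xs"

lemma length_drop_nth: "j < length xs \<Longrightarrow> length (drop_nth j xs) = length xs - 1"
  by (simp add: drop_nth_def)

lemma set_drop_nth_subset: "set (drop_nth j xs) \<subseteq> set xs"
  by (auto simp: drop_nth_def dest: in_set_takeD in_set_dropD)

lemma distinct_drop_nth: "distinct xs \<Longrightarrow> distinct (drop_nth j xs)"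
  by (simp add: drop_nth_def set_take_disj_set_drop_if_distinct)

lemma list_minor_Nil [simp]: "list_minor f [] cs = 1"
  by (simp add: list_minor_def det_dim_zero)

text \<open>Laplace expansion along the first row: deleting row 0 and column \<open>j\<close> leaves
  the minor on the remaining rows and \<open>drop_nth j cs\<close>. Every later induction on the
  rows goes through this recursion.\<close>

lemma list_minor_Cons:
  assumes "length cs = Suc (length rs)"
  shows "list_minor f (r # rs) cs =
    (\<Sum>j<length cs. (- 1) ^ j * f r (cs ! j) * list_minor f rs (drop_nth j cs))"
proof -
  let ?A = "mat (length cs) (length cs) (\<lambda>(a, b). f ((r # rs) ! a) (cs ! b))"
  have "mat_delete ?A 0 j = mat (length rs) (length rs) (\<lambda>(a, b). f (rs ! a) (drop_nth j cs ! b))"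
    if "j < length cs" for j
    by (rule eq_matI) (use that assms in \<open>auto simp: mat_delete_def drop_nth_def nth_append\<close>)
  moreover have "det ?A = (\<Sum>j<length cs. ?A $$ (0, j) * cofactor ?A 0 j)"
    by (rule laplace_expansion_row) (use assms in auto)
  ultimately show ?thesis
    using assms by (simp add: list_minor_def cofactor_def mult_ac)
qed

lemma laplacian_minors_eq:
  "laplacian_minors G i = {list_minor (laplacian G) rs cs | rs cs.
     distinct rs \<and> length rs = i \<and> set rs \<subseteq> verts G \<and>
     distinct cs \<and> length cs = i \<and> set cs \<subseteq> verts G}"
  unfolding laplacian_minors_def list_minor_def by fast

section \<open>Ideals of the polynomial ring\<close>

lemma zpoly_ring_ops:
  "p \<otimes>\<^bsub>zpoly_ring V\<^esub> q = p * q" "p \<oplus>\<^bsub>zpoly_ring V\<^esub> q = p + q"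
  "\<one>\<^bsub>zpoly_ring V\<^esub> = 1" "\<zero>\<^bsub>zpoly_ring V\<^esub> = 0"
  by (simp_all add: zpoly_ring_def)

lemma one_in_zpoly_ring: "1 \<in> carrier (zpoly_ring V)"
  by (simp add: zpoly_ring_def)

lemma indet_in_zpoly_ring: "u \<in> V \<Longrightarrow> indet u \<in> carrier (zpoly_ring V)"
  by (simp add: zpoly_ring_def indet_def)

lemma uminus_in_zpoly_ring:
  "p \<in> carrier (zpoly_ring V) \<Longrightarrow> - p \<in> carrier (zpoly_ring V)"
  by (simp add: zpoly_ring_def)

text \<open>Seen as an ideal, the carrier inherits its closure under sums and products from the
  closure laws for ideals below.\<close>

lemma ideal_carrier_zpoly_ring: "ideal (carrier (zpoly_ring V)) (zpoly_ring V)"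
  by (intro ring.oneideal cring.axioms cring_zpoly_ring)

lemma ideal_zpoly_subset:
  "ideal I (zpoly_ring V) \<Longrightarrow> p \<in> I \<Longrightarrow> p \<in> carrier (zpoly_ring V)"
  by (meson additive_subgroup.a_Hcarr ideal.axioms(1))

lemma ideal_zpoly_add:
  "ideal I (zpoly_ring V) \<Longrightarrow> p \<in> I \<Longrightarrow> q \<in> I \<Longrightarrow> p + q \<in> I"
  using additive_subgroup.a_closed[OF ideal.axioms(1)] by (fastforce simp: zpoly_ring_def)

lemma ideal_zpoly_mult:
  "ideal I (zpoly_ring V) \<Longrightarrow> c \<in> carrier (zpoly_ring V) \<Longrightarrow> p \<in> I \<Longrightarrow> c * p \<in> I"
  using ideal.I_l_closed[of I "zpoly_ring V" p c] by (simp add: zpoly_ring_def)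

lemma ideal_zpoly_zero: "ideal I (zpoly_ring V) \<Longrightarrow> 0 \<in> I"
  using additive_subgroup.zero_closed[OF ideal.axioms(1)] by (fastforce simp: zpoly_ring_def)

lemma ideal_zpoly_sum:
  "ideal I (zpoly_ring V) \<Longrightarrow> (\<And>j. j \<in> A \<Longrightarrow> f j \<in> I) \<Longrightarrow> sum f A \<in> I"
  by (induction A rule: infinite_finite_induct) (auto intro: ideal_zpoly_zero ideal_zpoly_add)

lemmas zpoly_ring_mult = ideal_zpoly_mult[OF ideal_carrier_zpoly_ring]

lemma of_nat_in_zpoly_ring: "of_nat n \<in> carrier (zpoly_ring V)"
  by (induction n)
    (auto intro: ideal_zpoly_add ideal_zpoly_zero ideal_carrier_zpoly_ring one_in_zpoly_ring)

lemma minus_one_power_in_zpoly_ring: "(- 1) ^ n \<in> carrier (zpoly_ring V)"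
  by (induction n) (auto intro: one_in_zpoly_ring uminus_in_zpoly_ring)

text \<open>The row vertex alone decides: an indeterminate occurs only on the diagonal, and all
  other entries are integers.\<close>

lemma laplacian_in_zpoly_ring: "u \<in> V \<Longrightarrow> laplacian G u v \<in> carrier (zpoly_ring V)"
  by (auto simp: laplacian_def indet_in_zpoly_ring of_nat_in_zpoly_ring uminus_in_zpoly_ring)

text \<open>By the row expansion the minor is a combination of smaller minors with coefficients in
  the ring. Taking \<open>I\<close> to be the whole ring shows that minors are polynomials in the
  vertex indeterminates; taking a critical ideal gives the descending chain.\<close>

lemma list_minor_in_ideal:
  assumes "ideal I (zpoly_ring V)" "length cs = Suc (length rs)" "r \<in> V"
    and "\<And>j. j < length cs \<Longrightarrow> list_minor (laplacian G) rs (drop_nth j cs) \<in> I"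
  shows "list_minor (laplacian G) (r # rs) cs \<in> I"
  unfolding list_minor_Cons[OF assms(2)]
  using assms by (intro ideal_zpoly_sum ideal_zpoly_mult zpoly_ring_mult)
    (auto intro: minus_one_power_in_zpoly_ring laplacian_in_zpoly_ring)

lemma list_minor_in_zpoly_ring:
  "length cs = length rs \<Longrightarrow> set rs \<subseteq> V \<Longrightarrow>
     list_minor (laplacian G) rs cs \<in> carrier (zpoly_ring V)"
  by (induction rs arbitrary: cs)
    (auto intro!: list_minor_in_ideal one_in_zpoly_ring ideal_carrier_zpoly_ring
      simp: length_drop_nth)

section \<open>Critical ideals: generators, triviality and the descending chain\<close>

lemma laplacian_minors_in_zpoly_ring: "laplacian_minors G i \<subseteq> carrier (zpoly_ring (verts G))"
  by (auto simp: laplacian_minors_eq list_minor_in_zpoly_ring)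

lemma ideal_critical_ideal: "ideal (critical_ideal G i) (zpoly_ring (verts G))"
  unfolding critical_ideal_def
  by (intro ring.genideal_ideal cring.axioms cring_zpoly_ring laplacian_minors_in_zpoly_ring)

lemma laplacian_minors_subset: "laplacian_minors G i \<subseteq> critical_ideal G i"
  unfolding critical_ideal_def
  by (intro ring.genideal_self cring.axioms cring_zpoly_ring laplacian_minors_in_zpoly_ring)

lemma critical_ideal_minimal:
  "ideal I (zpoly_ring (verts G)) \<Longrightarrow> laplacian_minors G i \<subseteq> I \<Longrightarrow> critical_ideal G i \<subseteq> I"
  unfolding critical_ideal_def
  by (intro ring.genideal_minimal cring.axioms cring_zpoly_ring)

text \<open>An ideal that contains 1 is the whole carrier, and so is the ideal generated by
  1.\<close>

lemma trivial_critical_ideal_iff: "trivial_critical_ideal G i \<longleftrightarrow> 1 \<in> critical_ideal G i"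
proof -
  interpret ring "zpoly_ring (verts G)"
    by (intro cring.axioms cring_zpoly_ring)
  have "Idl\<^bsub>zpoly_ring (verts G)\<^esub> {1} = carrier (zpoly_ring (verts G))"
    using genideal_one by (simp add: zpoly_ring_def)
  moreover have "critical_ideal G i = carrier (zpoly_ring (verts G))" if "1 \<in> critical_ideal G i"
    using ideal.one_imp_carrier[OF ideal_critical_ideal[of G i]] that by (simp add: zpoly_ring_def)
  ultimately show ?thesis
    using one_in_zpoly_ring by (auto simp: trivial_critical_ideal_def)
qed

text \<open>Expanding a generator along its first row leaves minors of size \<open>i\<close> on
  distinct rows and columns, which generate the larger ideal.\<close>

lemma critical_ideal_Suc_subset: "critical_ideal G (Suc i) \<subseteq> critical_ideal G i"
proof (rule critical_ideal_minimal[OF ideal_critical_ideal], rule subsetI)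
  fix p assume "p \<in> laplacian_minors G (Suc i)"
  then obtain rs cs where p: "p = list_minor (laplacian G) rs cs"
    and rs: "distinct rs" "length rs = Suc i" "set rs \<subseteq> verts G"
    and cs: "distinct cs" "length cs = Suc i" "set cs \<subseteq> verts G"
    by (auto simp: laplacian_minors_eq)
  obtain r rs' where r: "rs = r # rs'"
    using rs(2) by (cases rs) auto
  have "list_minor (laplacian G) rs' (drop_nth j cs) \<in> critical_ideal G i" if "j < length cs" for j
  proof (rule subsetD[OF laplacian_minors_subset])
    have "set (drop_nth j cs) \<subseteq> verts G"
      using cs(3) set_drop_nth_subset by fast
    then show "list_minor (laplacian G) rs' (drop_nth j cs) \<in> laplacian_minors G i"
      unfolding laplacian_minors_eq mem_Collect_eq
      using rs cs r that
      by (intro exI[of _ rs'] exI[of _ "drop_nth j cs"])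
        (simp add: distinct_drop_nth length_drop_nth)
  qed
  then show "p \<in> critical_ideal G i"
    using rs cs r p by (auto intro!: list_minor_in_ideal ideal_critical_ideal)
qed

text \<open>Triviality spreads down the chain to all indices from 1 to \<open>Suc k\<close>. The
  bound on the number of vertices keeps these inside the range over which
  \<open>algebraic_corank\<close> counts.\<close>

lemma forbidden_if_trivial:
  assumes "trivial_critical_ideal G (Suc k)" "Suc k \<le> card (verts G)"
  shows "forbidden k G"
proof -
  have "trivial_critical_ideal G i" if "i \<le> Suc k" for i
    using lift_Suc_antimono_le[of "critical_ideal G", OF critical_ideal_Suc_subset that] assms(1)
    by (auto simp: trivial_critical_ideal_iff)
  then have "card {1..Suc k} \<le> algebraic_corank G"
    unfolding algebraic_corank_def using assms(2) by (intro card_mono) auto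
  then show ?thesis
    by (simp add: forbidden_def)
qed

section \<open>Evaluation of polynomials\<close>

definition eval_monomial :: "('a \<Rightarrow> 'r :: comm_ring_1) \<Rightarrow> ('a \<Rightarrow>\<^sub>0 nat) \<Rightarrow> 'r" where
  "eval_monomial x m = (\<Prod>u \<in> Poly_Mapping.keys m. x u ^ Poly_Mapping.lookup m u)"

text \<open>The values may lie in any commutative ring, since the points used later have coordinates
  in the field with three elements; integer coefficients get there by \<open>of_int\<close>.\<close>

definition eval_zpoly :: "('a \<Rightarrow> 'r :: comm_ring_1) \<Rightarrow> 'a zpoly \<Rightarrow> 'r" where
  "eval_zpoly x p = (\<Sum>m \<in> Poly_Mapping.keys p. of_int (Poly_Mapping.lookup p m) * eval_monomial x m)"

lemma eval_monomial_add: "eval_monomial x (a + b) = eval_monomial x a * eval_monomial x b"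
proof -
  let ?K = "Poly_Mapping.keys a \<union> Poly_Mapping.keys b"
  \<comment> \<open>Products over different supports are compared on their union: outside the keys
    of \<open>m\<close> the exponent is 0 and the factor is 1.\<close>
  have *: "eval_monomial x m = (\<Prod>u \<in> ?K. x u ^ Poly_Mapping.lookup m u)" if "Poly_Mapping.keys m \<subseteq> ?K" for m
    unfolding eval_monomial_def
    by (rule prod.mono_neutral_left) (use that in \<open>auto simp: in_keys_iff\<close>)
  show ?thesis
    using Poly_Mapping.keys_add[of a b]
    by (simp add: * lookup_add power_add prod.distrib)
qed

lemma eval_zpoly_add: "eval_zpoly x (p + q) = eval_zpoly x p + eval_zpoly x q"
proof -
  let ?K = "Poly_Mapping.keys p \<union> Poly_Mapping.keys q"
  have *: "eval_zpoly x r = (\<Sum>m \<in> ?K. of_int (Poly_Mapping.lookup r m) * eval_monomial x m)"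
    if "Poly_Mapping.keys r \<subseteq> ?K" for r
    unfolding eval_zpoly_def
    by (rule sum.mono_neutral_left) (use that in \<open>auto simp: in_keys_iff\<close>)
  show ?thesis
    using Poly_Mapping.keys_add[of p q]
    by (simp add: * lookup_add distrib_right sum.distrib)
qed

lemma eval_zpoly_0: "eval_zpoly x 0 = 0"
  by (simp add: eval_zpoly_def)

lemma eval_zpoly_single:
  "eval_zpoly x (Poly_Mapping.single m c) = of_int c * eval_monomial x m"
  by (simp add: eval_zpoly_def)

text \<open>Reduces multiplicativity of the evaluation to products of two single terms.\<close>

lemma poly_mapping_single_add_induct [case_names zero single add]:
  fixes p :: "'a \<Rightarrow>\<^sub>0 'b :: monoid_add"
  assumes "P 0" "\<And>k v. P (Poly_Mapping.single k v)" "\<And>p q. P p \<Longrightarrow> P q \<Longrightarrow> P (p + q)"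
  shows "P p"
proof (induction p rule: update_induct)
  case (update p k v)
  \<comment> \<open>The key \<open>k\<close> lies outside the support of \<open>p\<close>, so
    overwriting the value 0 there is the same as adding.\<close>
  have "Poly_Mapping.update k v p = p + Poly_Mapping.single k v"
    by (rule poly_mapping_eqI)
      (use update in \<open>auto simp: lookup_update lookup_add lookup_single in_keys_iff when_def\<close>)
  with assms update show ?case
    by simp
qed fact

lemma eval_zpoly_mult: "eval_zpoly x (p * q) = eval_zpoly x p * eval_zpoly x q"
proof (induction p rule: poly_mapping_single_add_induct)
  case (single m c)
  show ?case
    by (induction q rule: poly_mapping_single_add_induct)
      (simp_all add: eval_zpoly_0 mult_single eval_zpoly_single eval_monomial_add eval_zpoly_add
        distrib_left distrib_right mult_ac)
qed (simp_all add: eval_zpoly_0 distrib_right eval_zpoly_add)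

lemma comm_ring_hom_eval_zpoly: "comm_ring_hom (eval_zpoly x)"
  by unfold_locales
    (simp_all add: eval_zpoly_add eval_zpoly_mult eval_zpoly_single eval_monomial_def
      flip: single_one, simp_all add: eval_zpoly_def)

lemma eval_zpoly_indet: "eval_zpoly x (indet u) = x u"
  by (simp add: indet_def eval_zpoly_single eval_monomial_def)

lemma eval_zpoly_laplacian:
  "eval_zpoly x (laplacian G u v) = (if u = v then x u else - of_nat (edge_mult G u v))"
proof -
  interpret comm_ring_hom "eval_zpoly x"
    by (rule comm_ring_hom_eval_zpoly)
  show ?thesis
    by (simp add: laplacian_def eval_zpoly_indet hom_distribs)
qed

lemma eval_list_minor:
  "eval_zpoly x (list_minor f rs cs) = list_minor (\<lambda>u v. eval_zpoly x (f u v)) rs cs"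
proof -
  interpret comm_ring_hom "eval_zpoly x"
    by (rule comm_ring_hom_eval_zpoly)
  show ?thesis
    unfolding list_minor_def hom_det[symmetric]
    by (rule arg_cong[of _ _ det]) (auto intro!: eq_matI)
qed

text \<open>The kernel of the evaluation at \<open>x\<close> is an ideal. If it contains the
  generators, it contains the critical ideal, but never 1, whose value is 1.\<close>

lemma nontrivial_critical_ideal:
  fixes x :: "'a \<Rightarrow> 'r :: comm_ring_1"
  assumes "\<And>p. p \<in> laplacian_minors G i \<Longrightarrow> eval_zpoly x p = 0"
  shows "\<not> trivial_critical_ideal G i"
proof -
  interpret comm_ring_hom "eval_zpoly x"
    by (rule comm_ring_hom_eval_zpoly)
  interpret R: cring "zpoly_ring (verts G)"
    by (rule cring_zpoly_ring)
  let ?I = "{p \<in> carrier (zpoly_ring (verts G)). eval_zpoly x p = 0}"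
  have "ideal ?I (zpoly_ring (verts G))"
  proof (rule idealI[OF R.ring_axioms])
    show "subgroup ?I (add_monoid (zpoly_ring (verts G)))"
    proof (rule subgroup.intro)
      fix p assume p: "p \<in> ?I"
      \<comment> \<open>The inverse in the additive monoid of the record is identified, by
        uniqueness, with the ordinary negative, to which the homomorphism law applies.\<close>
      have "\<ominus>\<^bsub>zpoly_ring (verts G)\<^esub> p = - p"
        by (rule R.minus_equality) (use p in \<open>auto simp: zpoly_ring_ops uminus_in_zpoly_ring\<close>)
      then show "inv\<^bsub>add_monoid (zpoly_ring (verts G))\<^esub> p \<in> ?I"
        using p uminus_in_zpoly_ring[of p] by (simp add: a_inv_def hom_uminus)
    qed (auto simp: zpoly_ring_ops eval_zpoly_add
        intro: ideal_zpoly_zero ideal_zpoly_add ideal_carrier_zpoly_ring)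
  qed (auto simp: zpoly_ring_ops eval_zpoly_mult zpoly_ring_mult)
  then have "critical_ideal G i \<subseteq> ?I"
    using assms laplacian_minors_in_zpoly_ring by (intro critical_ideal_minimal) auto
  then show ?thesis
    by (auto simp: trivial_critical_ideal_iff)
qed

text \<open>The matrix is a product with inner dimension \<open>k\<close>, less than its size.
  Padding the left factor with zero columns makes both factors square, so the determinant is
  multiplicative, and the left factor has determinant 0.\<close>

lemma list_minor_factor_eq_0:
  fixes a :: "nat \<Rightarrow> 'a \<Rightarrow> 'r :: comm_ring_1"
  assumes "k < length rs"
  shows "list_minor (\<lambda>u v. \<Sum>t<k. a t u * b t v) rs cs = 0"
proof -
  let ?n = "length rs"
  let ?P = "mat ?n ?n (\<lambda>(i, t). if t < k then a t (rs ! i) else 0)"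
  let ?Q = "mat ?n ?n (\<lambda>(t, j). b t (cs ! j))"
  \<comment> \<open>Column \<open>k\<close> is the first zero column of \<open>?P\<close>; it exists
    because \<open>k\<close> is less than the size.\<close>
  have "det ?P = (\<Sum>i<?n. ?P $$ (i, k) * cofactor ?P i k)"
    by (rule laplace_expansion_column) (use assms in auto)
  then have "det ?P = 0"
    using assms by simp
  moreover have "mat ?n ?n (\<lambda>(i, j). \<Sum>t<k. a t (rs ! i) * b t (cs ! j)) = ?P * ?Q"
    using assms
    by (intro eq_matI)
      (auto simp: scalar_prod_def intro!: sum.mono_neutral_cong_left split: if_splits)
  ultimately show ?thesis
    by (simp add: list_minor_def det_mult[of _ ?n])
qed

section \<open>Graphs of bounded rank\<close>

lemma list_minor_cong:
  assumes "length cs = length rs"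
    and "\<And>u v. u \<in> set rs \<Longrightarrow> v \<in> set cs \<Longrightarrow> f u v = g u v"
  shows "list_minor f rs cs = list_minor g rs cs"
  unfolding list_minor_def using assms
  by (intro arg_cong[of _ _ det] eq_matI) auto

lemma nontrivial_critical_ideal_if_rank:
  fixes a b :: "nat \<Rightarrow> 'a \<Rightarrow> 'r :: comm_ring_1"
  assumes mult: "\<And>u v. u \<in> verts G \<Longrightarrow> v \<in> verts G \<Longrightarrow> u \<noteq> v \<Longrightarrow>
      - of_nat (edge_mult G u v) = (\<Sum>t<k. a t u * b t v)"
    and "k < i"
  shows "\<not> trivial_critical_ideal G i"
proof (rule nontrivial_critical_ideal)
  fix p assume "p \<in> laplacian_minors G i"
  then obtain rs cs where p: "p = list_minor (laplacian G) rs cs"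
    and rs: "length rs = i" "set rs \<subseteq> verts G" and cs: "length cs = i" "set cs \<subseteq> verts G"
    by (auto simp: laplacian_minors_eq)
  \<comment> \<open>The graph prescribes only the off-diagonal entries. Each indeterminate takes the
    value that makes its diagonal entry fit the factorization as well.\<close>
  let ?x = "\<lambda>u. \<Sum>t<k. a t u * b t u"
  have "eval_zpoly ?x p = list_minor (\<lambda>u v. \<Sum>t<k. a t u * b t v) rs cs"
    unfolding p eval_list_minor
    using rs cs by (intro list_minor_cong) (auto simp: eval_zpoly_laplacian mult subset_iff)
  also have "\<dots> = 0"
    by (rule list_minor_factor_eq_0) (use assms rs in simp)
  finally show "eval_zpoly ?x p = 0" .
qed

lemma not_forbidden_if_rank:
  fixes a b :: "nat \<Rightarrow> 'a \<Rightarrow> 'r :: comm_ring_1"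
  assumes "\<And>u v. u \<in> verts G \<Longrightarrow> v \<in> verts G \<Longrightarrow> u \<noteq> v \<Longrightarrow>
      - of_nat (edge_mult G u v) = (\<Sum>t<k. a t u * b t v)"
  shows "\<not> forbidden k G"
proof -
  have "\<not> trivial_critical_ideal G i" if "k < i" for i
    using assms that by (rule nontrivial_critical_ideal_if_rank)
  then have "{i \<in> {1..card (verts G)}. trivial_critical_ideal G i} \<subseteq> {1..k}"
    by (auto intro!: leI)
  then have "algebraic_corank G \<le> k"
    unfolding algebraic_corank_def using card_mono[of "{1..k}"] by fastforce
  then show ?thesis
    by (simp add: forbidden_def)
qed

text \<open>Deleting single vertices is enough: every proper subset \<open>U\<close> misses some
  \<open>x\<close>, and a factorization for the vertices other than \<open>x\<close> restricts to
  \<open>U\<close>. It may depend on \<open>x\<close>.\<close>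

lemma Forb_Gamma_if_rank:
  assumes "is_graph G" "forbidden k G"
    and rank: "\<And>x. x \<in> verts G \<Longrightarrow> \<exists>a b :: nat \<Rightarrow> 'a \<Rightarrow> 'r :: comm_ring_1.
      \<forall>u \<in> verts G - {x}. \<forall>v \<in> verts G - {x}. u \<noteq> v \<longrightarrow>
        - of_nat (edge_mult G u v) = (\<Sum>t<k. a t u * b t v)"
  shows "G \<in> Forb_Gamma k"
proof -
  have "\<not> forbidden k (induced_subgraph G U)" if U: "U \<subset> verts G" for U
  proof -
    obtain x where x: "x \<in> verts G" "U \<subseteq> verts G - {x}"
      using U by blast
    obtain a b :: "nat \<Rightarrow> 'a \<Rightarrow> 'r" where
      "\<forall>u \<in> verts G - {x}. \<forall>v \<in> verts G - {x}. u \<noteq> v \<longrightarrow>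
        - of_nat (edge_mult G u v) = (\<Sum>t<k. a t u * b t v)"
      using rank[OF x(1)] by blast
    with x(2) show ?thesis
      by (intro not_forbidden_if_rank[where a = a and b = b])
        (auto simp: induced_subgraph_def subset_iff)
  qed
  with assms show ?thesis
    by (simp add: Forb_Gamma_def)
qed

section \<open>Minors as polynomials\<close>

text \<open>The Leibniz formula as a list of coefficients and monomials. The indeterminates in a monomial
  are listed in the order of the rows, so equal monomials are represented by equal lists.\<close>

fun minor_terms :: "('a \<Rightarrow> 'a \<Rightarrow> nat) \<Rightarrow> 'a list \<Rightarrow> 'a list \<Rightarrow> (int \<times> 'a list) list" where
  "minor_terms m [] cs = [(1, [])]"
| "minor_terms m (r # rs) cs = concat (map (\<lambda>j.
     if r = cs ! j then map (\<lambda>(k, us). ((- 1) ^ j * k, r # us)) (minor_terms m rs (drop_nth j cs))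
     else if m r (cs ! j) = 0 then []
     else map (\<lambda>(k, us). (- ((- 1) ^ j * int (m r (cs ! j)) * k), us))
       (minor_terms m rs (drop_nth j cs))) [0..<length cs])"

text \<open>Allows the terms to be computed with \<open>entry_mult\<close>, which agrees with the
  edge multiplicities only on vertices.\<close>

lemma minor_terms_cong:
  "set rs \<subseteq> V \<Longrightarrow> set cs \<subseteq> V \<Longrightarrow> (\<And>u v. u \<in> V \<Longrightarrow> v \<in> V \<Longrightarrow> m u v = m' u v) \<Longrightarrow>
     minor_terms m rs cs = minor_terms m' rs cs"
proof (induction rs arbitrary: cs)
  case (Cons r rs)
  have "minor_terms m rs (drop_nth j cs) = minor_terms m' rs (drop_nth j cs)" for j
    using Cons set_drop_nth_subset[of j cs] by auto
  moreover have "m r (cs ! j) = m' r (cs ! j)" if "j < length cs" for j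
    using Cons.prems that by (auto simp: subset_iff)
  ultimately show ?case
    by (auto intro!: arg_cong[of _ _ concat])
qed simp

section \<open>Collecting equal monomials and recognizing constant minors\<close>

definition term_value :: "int \<times> 'a list \<Rightarrow> 'a zpoly" where
  "term_value = (\<lambda>(k, us). of_int k * prod_list (map indet us))"

definition coefficient :: "(int \<times> 'a list) list \<Rightarrow> 'a list \<Rightarrow> int" where
  "coefficient ts us = sum_list (map fst (filter (\<lambda>t. snd t = us) ts))"

text \<open>A sufficient test by computation that the sum is constant: terms with indeterminates may
  occur as long as they cancel.\<close>

definition constant_terms :: "(int \<times> 'a list) list \<Rightarrow> bool" where
  "constant_terms ts \<longleftrightarrow> (\<forall>us \<in> set (map snd ts). us \<noteq> [] \<longrightarrow> coefficient ts us = 0)"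

text \<open>Induction on the rows: the \<open>j\<close>-th block of \<open>minor_terms\<close> has
  as its value the \<open>j\<close>-th summand of the row expansion. A block for multiplicity 0 is
  empty, in accordance with a zero summand.\<close>

lemma list_minor_laplacian_eq:
  "length cs = length rs \<Longrightarrow>
     list_minor (laplacian G) rs cs = sum_list (map term_value (minor_terms (edge_mult G) rs cs))"
proof (induction rs arbitrary: cs)
  case (Cons r rs)
  define ts where "ts j = minor_terms (edge_mult G) rs (drop_nth j cs)" for j
  let ?block = "\<lambda>j.
     if r = cs ! j then map (\<lambda>(k, us). ((- 1) ^ j * k, r # us)) (ts j)
     else if edge_mult G r (cs ! j) = 0 then []
     else map (\<lambda>(k, us). (- ((- 1) ^ j * int (edge_mult G r (cs ! j)) * k), us)) (ts j)"
  have diag: "sum_list (map term_value (map (\<lambda>(k, us). (c * k, q # us)) ts)) =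
      of_int c * indet q * sum_list (map term_value ts)" for c q ts
    by (induction ts) (auto simp: term_value_def algebra_simps)
  have off: "sum_list (map term_value (map (\<lambda>(k, us). (- (c * k), us)) ts)) =
      - (of_int c * sum_list (map term_value ts))" for c ts
    by (induction ts) (auto simp: term_value_def algebra_simps)
  have block: "sum_list (map term_value (?block j)) =
      (- 1) ^ j * laplacian G r (cs ! j) * list_minor (laplacian G) rs (drop_nth j cs)"
    if "j < length cs" for j
  proof -
    have "list_minor (laplacian G) rs (drop_nth j cs) = sum_list (map term_value (ts j))"
      using Cons that by (simp add: ts_def length_drop_nth)
    moreover have "laplacian G r (cs ! j) =
        (if r = cs ! j then indet r else - of_nat (edge_mult G r (cs ! j)))"
      by (simp add: laplacian_def)
    ultimately show ?thesis
      by (simp add: diag off del: map_map)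
  qed
  have concat: "sum_list (map h (concat xss)) = sum_list (map (\<lambda>xs. sum_list (map h xs)) xss)"
    for h :: "int \<times> 'a list \<Rightarrow> 'a zpoly" and xss
    by (induction xss) simp_all
  have "sum_list (map term_value (minor_terms (edge_mult G) (r # rs) cs)) =
      (\<Sum>j<length cs. sum_list (map term_value (?block j)))"
    unfolding minor_terms.simps ts_def[symmetric] concat map_map
    by (simp only: o_def interv_sum_list_conv_sum_set_nat lessThan_atLeast0 set_upt)
  also have "\<dots> = list_minor (laplacian G) (r # rs) cs"
    using Cons.prems
    by (subst list_minor_Cons) (auto intro!: sum.cong simp only: lessThan_iff block length_Cons)
  finally show ?case ..
qed (simp add: term_value_def)

text \<open>The set \<open>A\<close> may exceed the lists that occur. This keeps it fixed during the
  induction and lets \<open>[]\<close> be included below even if no constant term is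
  present.\<close>

lemma sum_list_term_value:
  assumes "finite A" "set (map snd ts) \<subseteq> A"
  shows "sum_list (map term_value ts) = (\<Sum>us\<in>A. term_value (coefficient ts us, us))"
  using assms(2)
proof (induction ts)
  case (Cons t ts)
  obtain k us where t: "t = (k, us)"
    by fastforce
  have "term_value (coefficient (t # ts) vs, vs) =
      (if vs = us then term_value (k, us) else 0) + term_value (coefficient ts vs, vs)" for vs
    by (simp add: t coefficient_def term_value_def distrib_right)
  with Cons t assms(1) show ?case
    by (simp add: sum.distrib)
qed (simp add: coefficient_def term_value_def)

lemma sum_list_constant_terms:
  assumes "constant_terms ts"
  shows "sum_list (map term_value ts) = of_int (coefficient ts [])"
proof -
  have "sum_list (map term_value ts) =
      (\<Sum>us \<in> insert [] (set (map snd ts)). term_value (coefficient ts us, us))"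
    by (rule sum_list_term_value) auto
  also have "\<dots> = (\<Sum>us \<in> {[]}. term_value (coefficient ts us, us))"
    by (rule sum.mono_neutral_right)
      (use assms in \<open>auto simp: constant_terms_def term_value_def\<close>)
  finally show ?thesis
    by (simp add: term_value_def)
qed

lemma forbidden_if_unit_minor:
  assumes rs: "distinct rs" "length rs = Suc k" "set rs \<subseteq> verts G"
    and cs: "distinct cs" "length cs = Suc k" "set cs \<subseteq> verts G"
    and "finite (verts G)"
    and "constant_terms (minor_terms (edge_mult G) rs cs)"
    and c: "\<bar>coefficient (minor_terms (edge_mult G) rs cs) []\<bar> = 1"
  shows "forbidden k G"
proof (rule forbidden_if_trivial)
  let ?c = "coefficient (minor_terms (edge_mult G) rs cs) []"
  have "list_minor (laplacian G) rs cs = of_int ?c"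
    using assms by (simp add: list_minor_laplacian_eq sum_list_constant_terms)
  moreover have "list_minor (laplacian G) rs cs \<in> laplacian_minors G (Suc k)"
    using rs cs by (auto simp: laplacian_minors_eq)
  ultimately have c_in: "of_int ?c \<in> critical_ideal G (Suc k)"
    using laplacian_minors_subset[of G "Suc k"] by auto
  \<comment> \<open>Squaring turns both possible values 1 and -1 into 1.\<close>
  have "of_int ?c * of_int ?c \<in> critical_ideal G (Suc k)"
    by (rule ideal_zpoly_mult[OF ideal_critical_ideal _ c_in])
      (rule ideal_zpoly_subset[OF ideal_critical_ideal c_in])
  moreover have "?c = 1 \<or> ?c = - 1"
    using c by linarith
  ultimately show "trivial_critical_ideal G (Suc k)"
    by (auto simp: trivial_critical_ideal_iff)
  show "Suc k \<le> card (verts G)"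
    using card_mono[OF \<open>finite (verts G)\<close> rs(3)] rs by (simp add: distinct_card)
qed

section \<open>Certificates\<close>

text \<open>A list in a fixed order, because a certificate assigns its vectors to the vertices by
  position.\<close>

definition entry_vertices :: "(nat \<times> nat) list \<times> nat list \<times> nat list \<Rightarrow> (nat \<times> nat) list" where
  "entry_vertices = (\<lambda>(es, W, B). [(u, i).
     u \<leftarrow> sort (remdups (map fst es @ map snd es)), i \<leftarrow> [0..<if u \<in> set (W @ B) then 2 else 1]])"

text \<open>Without a test for membership in the vertex set this is cheap to evaluate, and it is
  symmetric on all arguments.\<close>

fun entry_mult ::
    "(nat \<times> nat) list \<times> nat list \<times> nat list \<Rightarrow> nat \<times> nat \<Rightarrow> nat \<times> nat \<Rightarrow> nat" where
  "entry_mult (es, W, B) (u, i) (v, j) =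
     (if u = v then if i \<noteq> j \<and> u \<in> set B then 1 else 0
      else if (u, v) \<in> set es \<or> (v, u) \<in> set es then 1 else 0)"

lemma verts_entry_graph: "verts (entry_graph e) = set (entry_vertices e)"
  by (cases e) (auto simp: entry_graph_def substitution_def entry_vertices_def edge_list_graph_def)

lemma edge_mult_entry_graph:
  "x \<in> verts (entry_graph e) \<Longrightarrow> y \<in> verts (entry_graph e) \<Longrightarrow>
     edge_mult (entry_graph e) x y = entry_mult e x y"
  by (cases e; cases x; cases y)
    (auto simp: entry_graph_def substitution_def edge_list_graph_def)

lemma is_graph_substitution: "is_graph H \<Longrightarrow> is_graph (substitution H n clique)"
  by (auto simp: is_graph_def substitution_def split: if_splits)

lemma is_graph_edge_list_graph:
  "\<forall>(u, v) \<in> set es. u \<noteq> v \<Longrightarrow> is_graph (edge_list_graph es)"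
  by (auto simp: is_graph_def edge_list_graph_def intro: rev_image_eqI)

section \<open>Representations by ternary forms modulo 3\<close>

text \<open>Over the field with three elements a nondegenerate ternary form is determined by its
  discriminant up to isometry, so $\epsilon = \pm 1$ covers all of them; both signs are needed.\<close>

fun form :: "int \<Rightarrow> int \<times> int \<times> int \<Rightarrow> int \<times> int \<times> int \<Rightarrow> int" where
  "form \<epsilon> (a, b, c) (a', b', c') = a * a' + b * b' + \<epsilon> * c * c'"

text \<open>Only pairs at increasing positions are tested, as the form is symmetric. The values of
  the form on the diagonal stay free: they determine the point of evaluation.\<close>

definition represents ::
    "('a \<Rightarrow> 'a \<Rightarrow> nat) \<Rightarrow> int \<Rightarrow> 'a list \<Rightarrow> (int \<times> int \<times> int) list \<Rightarrow> bool" where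
  "represents m \<epsilon> us ws \<longleftrightarrow> length us = length ws \<and>
     sorted_wrt (\<lambda>(u, a) (v, b). (form \<epsilon> a b - int (m u v)) mod 3 = 0) (zip us ws)"

text \<open>The minus sign and \<open>\<epsilon>\<close> are absorbed by the left factor, which
  gives the sum of three products that the rank criterion asks for.\<close>

lemma of_int_form:
  "- of_int (form \<epsilon> p q) = (\<Sum>t<3. (case p of (a, b, c) \<Rightarrow> - of_int ([a, b, \<epsilon> * c] ! t)) *
     (case q of (a, b, c) \<Rightarrow> (of_int ([a, b, c] ! t) :: 'r :: comm_ring_1)))"
  by (cases p; cases q) (simp add: eval_nat_numeral algebra_simps)

text \<open>The type \<open>3\<close> is the ring of integers modulo 3, so this equation turns
  congruences into equalities.\<close>

lemma three_eq_0: "(3 :: 3) = 0"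
  by simp

text \<open>Passes from integer congruences at ordered positions to a factorization over the field
  with three elements, valid for every pair of distinct vertices.\<close>

lemma representsE:
  fixes m :: "'a \<Rightarrow> 'a \<Rightarrow> nat"
  assumes "represents m \<epsilon> us ws" and sym: "\<And>u v. m u v = m v u"
  obtains a b :: "nat \<Rightarrow> 'a \<Rightarrow> 3" where
    "\<And>u v. u \<in> set us \<Longrightarrow> v \<in> set us \<Longrightarrow> u \<noteq> v \<Longrightarrow> - of_nat (m u v) = (\<Sum>t<3. a t u * b t v)"
proof -
  define w where "w u = the (map_of (zip us ws) u)" for u
  let ?a = "\<lambda>t u. case w u of (a, b, c) \<Rightarrow> (- of_int ([a, b, \<epsilon> * c] ! t) :: 3)"
  let ?b = "\<lambda>t u. case w u of (a, b, c) \<Rightarrow> (of_int ([a, b, c] ! t) :: 3)"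
  have w: "(u, w u) \<in> set (zip us ws)" if "u \<in> set us" for u
    using that assms(1) unfolding w_def represents_def
    by (metis domIff map_of_SomeD dom_map_of_zip option.exhaust_sel)
  let ?P = "\<lambda>(u, a) (v, b). (form \<epsilon> a b - int (m u v)) mod 3 = 0"
  have P_sym: "?P p q" if "?P q p" for p q
  proof -
    have "form \<epsilon> a b = form \<epsilon> b a" for a b
      by (cases a; cases b) simp
    with that sym show ?thesis
      by (metis (no_types, lifting) case_prod_unfold)
  qed
  have "- of_nat (m u v) = (\<Sum>t<3. ?a t u * ?b t v)"
    if uv: "u \<in> set us" "v \<in> set us" "u \<noteq> v" for u v
  proof -
    have "(form \<epsilon> (w u) (w v) - int (m u v)) mod 3 = 0"
    proof -
      \<comment> \<open>Distinct vertices occupy distinct positions; whichever comes first, the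
        tested congruence applies directly or through \<open>P_sym\<close>.\<close>
      obtain i j where ij: "i < length (zip us ws)" "zip us ws ! i = (u, w u)"
          "j < length (zip us ws)" "zip us ws ! j = (v, w v)"
        using w uv(1,2) by (metis in_set_conv_nth)
      with uv(3) have "i < j \<or> j < i"
        by (metis fst_conv linorder_neqE_nat)
      then have "?P (u, w u) (v, w v)"
        using assms(1) sorted_wrt_nth_less[of ?P "zip us ws"] P_sym ij
        unfolding represents_def by metis
      then show ?thesis
        by simp
    qed
    then obtain k where "form \<epsilon> (w u) (w v) = int (m u v) + 3 * k"
      by (metis add.commute diff_eq_eq mod_0_imp_dvd dvd_def)
    moreover have "3 * of_int k = (0 :: 3)"
      by (simp only: mult_zero_left three_eq_0)
    ultimately have "of_nat (m u v) = (of_int (form \<epsilon> (w u) (w v)) :: 3)"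
      by simp
    then show ?thesis
      by (rule trans[OF arg_cong[of _ _ uminus] of_int_form])
  qed
  then show thesis
    by (rule that)
qed

text \<open>Every clause is decidable by computing with lists and integers. The clause on the edges
  excludes loops, so that the entry describes a graph.\<close>

definition certifies ::
    "(nat \<times> nat) list \<times> nat list \<times> nat list \<Rightarrow>
     (nat \<times> nat) list \<times> (nat \<times> nat) list \<times> (nat \<times> int \<times> (int \<times> int \<times> int) list) list \<Rightarrow> bool"
  where
  "certifies e = (\<lambda>(rs, cs, ws).
     let vs = entry_vertices e; ts = minor_terms (entry_mult e) rs cs in
     (\<forall>(u, v) \<in> set (fst e). u \<noteq> v) \<and>
     distinct rs \<and> length rs = 4 \<and> set rs \<subseteq> set vs \<and>
     distinct cs \<and> length cs = 4 \<and> set cs \<subseteq> set vs \<and>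
     constant_terms ts \<and> \<bar>coefficient ts []\<bar> = 1 \<and>
     (\<forall>x \<in> set vs. \<exists>(u, \<epsilon>, w) \<in> set ws. fst x = u \<and>
        represents (entry_mult e) \<epsilon> (filter (\<lambda>y. y \<noteq> x) vs) w))"

lemma Forb_Gamma_if_certifies:
  assumes "certifies e c"
  shows "entry_graph e \<in> Forb_Gamma 3"
proof -
  let ?G = "entry_graph e"
  obtain rs cs ws where c: "c = (rs, cs, ws)"
    by (cases c)
  note cert = assms[unfolded c certifies_def Let_def prod.case
      verts_entry_graph[symmetric]]
  have G: "is_graph ?G"
    using cert by (cases e)
      (auto simp: entry_graph_def intro!: is_graph_substitution is_graph_edge_list_graph)
  \<comment> \<open>The certificate was computed with \<open>entry_mult\<close>; its rows and
    columns are vertices, where both multiplicities agree.\<close>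
  have "minor_terms (edge_mult ?G) rs cs = minor_terms (entry_mult e) rs cs"
    by (rule minor_terms_cong[of _ "verts ?G"]) (use cert in \<open>auto intro: edge_mult_entry_graph\<close>)
  then have forb: "forbidden 3 ?G"
    by (intro forbidden_if_unit_minor[of rs _ _ cs]) (use cert in \<open>auto simp: verts_entry_graph\<close>)
  have sym: "entry_mult e u v = entry_mult e v u" for u v
    by (cases e; cases u; cases v) auto
  have "\<exists>a b :: nat \<Rightarrow> nat \<times> nat \<Rightarrow> 3. \<forall>u \<in> verts ?G - {x}. \<forall>v \<in> verts ?G - {x}. u \<noteq> v \<longrightarrow>
      - of_nat (edge_mult ?G u v) = (\<Sum>t<3. a t u * b t v)" if x: "x \<in> verts ?G" for x
  proof -
    obtain \<epsilon> w where "represents (entry_mult e) \<epsilon> (filter (\<lambda>y. y \<noteq> x) (entry_vertices e)) w"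
      using cert x by auto
    then obtain a b :: "nat \<Rightarrow> nat \<times> nat \<Rightarrow> 3" where
      "\<And>u v. u \<in> verts ?G - {x} \<Longrightarrow> v \<in> verts ?G - {x} \<Longrightarrow> u \<noteq> v \<Longrightarrow>
        - of_nat (entry_mult e u v) = (\<Sum>t<3. a t u * b t v)"
      by (rule representsE[OF _ sym]) (auto simp: verts_entry_graph)
    then show ?thesis
      by (intro exI[of _ a] exI[of _ b]) (auto simp: edge_mult_entry_graph)
  qed
  then show ?thesis
    by (rule Forb_Gamma_if_rank[OF G forb])
qed

text \<open>An entry consists of the rows and the columns of a unit minor and, for each \<open>u\<close>, of the
  form and the vectors for the deletion of a copy of \<open>u\<close>. Copies of the same vertex are twins:
  after the deletion of either one the same list of vectors fits the remaining vertices.\<close>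

definition F3_witnesses ::
    "((nat \<times> nat) list \<times> (nat \<times> nat) list \<times> (nat \<times> int \<times> (int \<times> int \<times> int) list) list) list"
  where
  "F3_witnesses = [
    ([(1,0), (2,0), (3,0), (4,0)],
     [(2,0), (3,0), (4,0), (5,0)],
     [(1, 1, [(1,0,0), (1,1,0), (0,1,1), (0,0,1)]),
      (2, 1, [(0,0,0), (1,0,0), (1,1,0), (0,1,0)]),
      (3, 1, [(1,0,0), (1,0,0), (0,1,0), (0,1,0)]),
      (4, 1, [(1,0,0), (1,1,0), (0,1,0), (0,0,0)]),
      (5, 1, [(1,0,0), (1,1,0), (0,1,1), (0,0,1)])]),
    ([(1,0), (4,0), (5,0), (6,0)],
     [(1,1), (4,1), (5,0), (6,0)],
     [(1, 1, [(1,1,0), (1,-1,1), (1,-1,1), (0,1,1), (0,0,1)]),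
      (4, 1, [(1,1,1), (1,1,1), (1,0,-1), (0,1,0), (0,1,-1)]),
      (5, 1, [(0,0,0), (0,0,0), (1,0,0), (0,1,0), (1,1,0)]),
      (6, 1, [(1,0,0), (0,1,0), (0,0,0), (0,0,0), (1,1,0)])]),
    ([(1,0), (4,0), (5,0), (6,0)],
     [(2,0), (4,1), (5,0), (6,0)],
     [(1, 1, [(1,1,0), (1,-1,1), (1,-1,1), (0,1,1), (0,0,1)]),
      (2, 1, [(1,0,0), (0,1,0), (0,0,1), (1,0,0), (1,1,1)]),
      (4, 1, [(1,0,0), (0,1,0), (0,0,1), (1,1,0), (1,0,1)]),
      (5, 1, [(1,0,0), (0,0,0), (0,1,0), (0,0,1), (1,1,1)]),
      (6, 1, [(1,0,0), (0,1,0), (0,0,0), (0,0,0), (1,1,0)])]),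
    ([(1,0), (4,0), (5,0), (6,0)],
     [(1,1), (4,1), (5,0), (6,0)],
     [(1, 1, [(1,1,0), (1,-1,1), (1,-1,1), (0,1,1), (1,0,0)]),
      (4, 1, [(1,0,0), (0,1,1), (0,1,-1), (1,-1,-1), (1,1,0)]),
      (5, 1, [(1,1,0), (1,-1,1), (1,-1,1), (1,-1,1), (1,0,0)]),
      (6, 1, [(1,0,0), (0,1,0), (0,0,0), (0,0,0), (1,1,0)])]),
    ([(1,0), (4,0), (5,0), (6,0)],
     [(1,1), (4,1), (5,0), (6,0)],
     [(1, 1, [(1,0,0), (0,1,0), (0,0,1), (1,0,0), (1,1,1)]),
      (4, 1, [(1,1,0), (1,-1,0), (0,0,1), (1,0,0), (1,0,1)]),
      (5, 1, [(1,1,0), (1,-1,1), (1,-1,1), (1,-1,1), (1,0,0)]),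
      (6, 1, [(1,0,0), (0,1,0), (0,0,0), (0,0,0), (1,1,0)])]),
    ([(1,0), (3,0), (5,0), (6,0)],
     [(1,1), (4,0), (5,0), (6,0)],
     [(1, 1, [(1,0,0), (0,1,0), (0,0,1), (1,1,0), (1,0,1)]),
      (3, 1, [(1,1,0), (1,-1,0), (0,0,1), (1,0,0), (1,0,1)]),
      (4, 1, [(1,1,0), (1,-1,0), (0,0,1), (1,0,1), (1,0,0)]),
      (5, 1, [(1,0,0), (0,1,0), (0,0,0), (0,0,1), (1,1,1)]),
      (6, 1, [(1,0,0), (0,1,0), (0,0,1), (0,0,0), (1,1,1)])]),
    ([(1,0), (2,0), (3,0), (6,0)],
     [(1,1), (2,0), (5,0), (6,0)],
     [(1, 1, [(1,1,1), (1,0,-1), (1,1,1), (0,1,-1), (1,0,0)]),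
      (2, 1, [(1,0,0), (1,0,0), (0,1,0), (0,0,0), (1,1,0)]),
      (3, 1, [(1,0,0), (1,0,0), (0,1,0), (0,1,1), (1,1,-1)]),
      (5, 1, [(1,0,0), (1,0,0), (0,1,0), (0,0,1), (1,1,1)]),
      (6, 1, [(1,0,0), (1,0,0), (0,1,0), (0,0,0), (0,1,0)])]),
    ([(1,0), (2,0), (4,0), (5,0)],
     [(1,0), (2,1), (5,0), (6,0)],
     [(1, 1, [(1,0,0), (0,1,0), (0,0,0), (1,1,1), (1,1,-1)]),
      (2, 1, [(1,0,0), (0,1,0), (1,0,1), (0,1,0), (1,1,-1)]),
      (4, 1, [(1,0,0), (0,1,1), (0,1,-1), (0,1,0), (1,1,0)]),
      (5, 1, [(1,1,0), (1,-1,1), (1,-1,1), (0,1,1), (1,0,0)]),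
      (6, 1, [(1,0,0), (0,1,0), (0,0,1), (1,0,0), (0,1,1)])]),
    ([(1,0), (2,0), (3,0), (5,0)],
     [(1,0), (4,0), (5,0), (6,0)],
     [(1, 1, [(1,0,0), (0,1,0), (0,0,0), (1,0,1), (0,1,1)]),
      (2, 1, [(1,1,0), (0,0,1), (1,0,0), (0,1,0), (0,1,1)]),
      (3, 1, [(1,1,0), (0,0,1), (1,0,0), (0,1,1), (0,1,0)]),
      (4, 1, [(1,0,0), (0,1,0), (0,0,1), (1,1,0), (1,0,1)]),
      (5, 1, [(1,0,0), (0,0,0), (0,1,0), (1,0,1), (1,1,-1)]),
      (6, 1, [(1,0,0), (0,1,0), (0,0,0), (1,0,1), (1,1,-1)])]),
    ([(1,0), (2,0), (3,0), (5,0)],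
     [(1,0), (4,0), (5,0), (6,0)],
     [(1, 1, [(1,0,0), (0,1,0), (0,0,0), (1,0,1), (1,1,-1)]),
      (2, 1, [(1,0,0), (0,1,1), (1,1,-1), (1,1,-1), (1,0,1)]),
      (3, 1, [(1,0,0), (0,1,0), (1,0,1), (1,1,-1), (1,1,-1)]),
      (4, 1, [(1,0,0), (0,1,1), (0,1,-1), (1,-1,-1), (1,1,0)]),
      (5, 1, [(1,1,0), (1,-1,1), (1,-1,1), (0,1,1), (1,0,0)]),
      (6, 1, [(1,0,0), (0,1,0), (0,0,0), (1,0,1), (1,1,-1)])]),
    ([(1,0), (2,0), (3,0), (5,0)],
     [(1,0), (4,0), (5,0), (6,0)],
     [(1, 1, [(1,0,0), (0,1,0), (0,0,0), (1,0,0), (1,1,0)]),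
      (2, 1, [(1,1,0), (0,0,1), (1,0,0), (0,1,0), (0,1,1)]),
      (3, 1, [(1,1,0), (1,-1,1), (0,1,1), (1,0,0), (1,0,0)]),
      (4, 1, [(1,1,0), (1,-1,0), (0,0,1), (1,0,0), (1,0,1)]),
      (5, 1, [(1,1,0), (1,-1,1), (1,-1,1), (0,1,1), (1,0,0)]),
      (6, 1, [(1,0,0), (0,1,0), (0,0,0), (1,0,1), (1,1,-1)])]),
    ([(1,0), (2,0), (3,0), (5,0)],
     [(1,0), (4,0), (5,0), (6,0)],
     [(1, 1, [(1,1,0), (1,-1,1), (1,-1,1), (0,1,1), (1,0,0)]),
      (2, 1, [(1,1,0), (0,0,1), (1,0,0), (0,1,0), (1,0,1)]),
      (3, 1, [(1,0,0), (0,1,1), (1,1,-1), (1,0,1), (1,-1,-1)]),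
      (4, 1, [(1,0,0), (0,1,1), (0,1,-1), (1,-1,-1), (1,1,0)]),
      (5, 1, [(1,0,0), (0,1,0), (0,0,1), (1,0,0), (1,1,1)]),
      (6, 1, [(1,0,0), (0,1,0), (0,0,0), (1,0,1), (1,1,-1)])]),
    ([(1,0), (2,0), (3,0), (5,0)],
     [(1,0), (4,0), (5,0), (6,0)],
     [(1, 1, [(1,0,0), (0,1,0), (0,0,1), (1,0,0), (1,1,1)]),
      (2, 1, [(1,0,0), (0,1,0), (1,0,1), (1,0,-1), (1,1,0)]),
      (3, 1, [(1,1,0), (0,0,1), (1,0,0), (0,1,1), (1,0,1)]),
      (4, 1, [(1,1,0), (1,-1,0), (0,0,1), (1,0,0), (1,0,1)]),
      (5, 1, [(1,0,0), (0,1,0), (0,0,1), (1,0,0), (1,1,1)]),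
      (6, 1, [(1,0,0), (0,1,0), (0,0,0), (1,0,1), (1,1,-1)])]),
    ([(1,0), (2,0), (3,0), (6,0)],
     [(1,1), (2,0), (5,0), (6,0)],
     [(1, 1, [(1,1,0), (1,-1,0), (0,0,1), (1,0,0), (1,0,1)]),
      (2, 1, [(1,0,0), (1,0,0), (0,1,0), (1,0,0), (1,1,0)]),
      (3, 1, [(1,0,0), (1,0,0), (0,1,0), (1,1,1), (1,1,-1)]),
      (5, 1, [(1,0,0), (1,0,0), (0,1,0), (0,0,1), (1,1,1)]),
      (6, 1, [(1,0,0), (1,0,0), (0,1,0), (0,0,0), (1,1,0)])]),
    ([(1,0), (2,0), (3,0), (5,0)],
     [(1,0), (4,0), (5,0), (6,0)],
     [(1, 1, [(1,0,0), (0,1,0), (0,0,1), (1,1,0), (1,0,1)]),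
      (2, 1, [(1,0,0), (0,1,0), (1,0,1), (1,1,-1), (1,0,0)]),
      (3, 1, [(1,1,0), (0,0,1), (1,0,0), (0,1,1), (1,0,1)]),
      (4, 1, [(1,1,0), (1,-1,0), (0,0,1), (1,0,1), (1,0,0)]),
      (5, 1, [(1,0,0), (0,1,0), (0,0,0), (1,0,0), (1,1,0)]),
      (6, 1, [(1,1,0), (1,-1,1), (1,-1,1), (0,1,1), (1,0,0)])]),
    ([(1,0), (2,0), (4,0), (5,0)],
     [(2,1), (4,0), (5,0), (6,0)],
     [(1, 1, [(1,0,0), (0,1,1), (0,1,-1), (1,-1,-1), (1,1,0)]),
      (2, 1, [(1,0,0), (0,1,1), (1,1,-1), (1,0,1), (1,-1,-1)]),
      (4, 1, [(1,0,0), (0,1,0), (0,0,1), (1,1,1), (1,1,1)]),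
      (5, 1, [(1,0,0), (0,1,0), (0,0,1), (1,0,0), (1,1,1)]),
      (6, 1, [(1,1,0), (1,-1,1), (1,-1,1), (0,1,1), (1,0,0)])]),
    ([(1,0), (2,0), (4,0), (5,0)],
     [(2,1), (4,0), (5,0), (6,0)],
     [(1, 1, [(1,1,0), (1,-1,0), (0,0,1), (1,0,0), (1,0,1)]),
      (2, 1, [(1,1,0), (0,0,1), (1,0,0), (0,1,1), (1,0,1)]),
      (4, 1, [(1,1,0), (1,-1,1), (1,-1,1), (1,0,0), (1,0,0)]),
      (5, 1, [(1,0,0), (0,1,0), (0,0,1), (1,0,0), (1,1,1)]),
      (6, 1, [(1,1,0), (1,-1,1), (1,-1,1), (0,1,1), (1,0,0)])]),
    ([(1,0), (2,0), (4,0), (5,0)],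
     [(2,0), (3,0), (5,0), (6,0)],
     [(1, 1, [(1,1,1), (1,0,-1), (0,1,0), (0,1,-1), (-1,1,1)]),
      (2, 1, [(1,0,0), (0,1,0), (1,0,0), (1,1,1), (1,1,1)]),
      (3, 1, [(1,1,0), (0,0,1), (1,0,1), (1,0,0), (0,1,1)]),
      (4, 1, [(1,0,0), (0,1,1), (0,1,-1), (1,-1,1), (1,1,0)]),
      (5, 1, [(1,1,0), (1,-1,0), (0,0,1), (1,0,0), (1,0,1)]),
      (6, 1, [(1,0,0), (0,1,0), (0,0,1), (1,1,0), (1,0,1)])]),
    ([(1,0), (2,0), (4,0), (5,0)],
     [(2,0), (3,0), (5,0), (6,0)],
     [(1, 1, [(1,0,0), (0,1,0), (1,0,1), (0,1,1), (1,1,0)]),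
      (2, 1, [(1,0,0), (0,1,0), (1,0,0), (1,1,1), (1,1,-1)]),
      (3, 1, [(1,0,0), (0,1,0), (1,1,1), (1,0,0), (1,1,-1)]),
      (4, 1, [(1,1,0), (0,0,1), (1,-1,0), (1,0,0), (1,0,1)]),
      (5, 1, [(1,1,0), (1,-1,0), (0,0,1), (1,0,0), (1,0,1)]),
      (6, 1, [(1,0,0), (0,1,0), (0,0,1), (1,1,0), (1,0,1)])]),
    ([(1,0), (2,0), (5,0), (6,0)],
     [(2,0), (3,0), (5,1), (6,0)],
     [(1, 1, [(1,1,0), (0,0,1), (1,0,0), (1,0,0), (1,-1,1)]),
      (2, 1, [(1,0,0), (0,1,0), (1,0,0), (1,0,0), (1,1,0)]),
      (3, 1, [(1,0,0), (0,1,0), (1,1,1), (1,1,-1), (1,0,0)]),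
      (5, 1, [(1,0,0), (0,1,0), (0,0,1), (1,1,0), (1,0,1)]),
      (6, 1, [(1,0,0), (0,1,0), (0,0,0), (1,1,1), (1,1,-1)])]),
    ([(1,0), (2,0), (4,0), (5,0)],
     [(1,1), (2,0), (4,0), (6,0)],
     [(1, 1, [(1,1,1), (1,0,-1), (0,1,-1), (1,0,0), (1,-1,1)]),
      (2, 1, [(1,0,0), (1,0,0), (0,1,0), (1,0,0), (1,1,0)]),
      (4, 1, [(1,0,0), (1,0,0), (0,1,0), (1,1,0), (1,0,0)]),
      (5, 1, [(1,0,0), (1,0,0), (0,1,0), (0,1,1), (1,0,1)]),
      (6, 1, [(1,0,0), (1,0,0), (0,1,0), (0,1,1), (1,1,-1)])]),
    ([(1,0), (2,0), (3,0), (5,0)],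
     [(1,0), (2,0), (4,0), (6,0)],
     [(1, 1, [(1,1,0), (0,0,1), (1,0,0), (0,1,1), (1,0,0)]),
      (2, 1, [(1,1,0), (1,0,0), (0,0,1), (1,0,0), (0,1,1)]),
      (3, 1, [(1,1,0), (0,0,1), (1,-1,1), (0,1,1), (-1,-1,1)]),
      (4, 1, [(1,0,0), (0,1,1), (1,1,-1), (1,-1,-1), (1,0,1)]),
      (5, 1, [(1,0,0), (0,1,0), (1,0,1), (0,1,0), (1,1,-1)]),
      (6, 1, [(1,0,0), (0,1,0), (1,0,0), (0,1,1), (1,1,-1)])]),
    ([(1,0), (2,0), (3,0), (5,0)],
     [(1,0), (2,0), (4,0), (6,0)],
     [(1, 1, [(1,0,0), (0,1,0), (1,0,1), (1,1,-1), (1,0,0)]),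
      (2, 1, [(1,0,0), (1,1,0), (0,0,1), (1,0,0), (1,-1,1)]),
      (3, 1, [(1,0,0), (0,1,1), (0,1,0), (1,0,1), (1,1,0)]),
      (4, 1, [(1,1,0), (0,0,1), (1,0,0), (1,0,1), (0,1,1)]),
      (5, 1, [(1,0,0), (0,1,0), (1,0,1), (0,1,0), (1,1,-1)]),
      (6, 1, [(1,0,0), (0,1,0), (1,0,0), (0,1,1), (1,1,-1)])]),
    ([(1,0), (2,0), (4,0), (5,0)],
     [(1,1), (2,0), (5,0), (6,0)],
     [(1, 1, [(1,1,0), (0,0,1), (1,0,0), (0,1,1), (1,0,1)]),
      (2, 1, [(1,0,0), (1,0,0), (1,1,0), (1,-1,0), (1,0,0)]),
      (4, 1, [(1,0,0), (1,0,0), (0,1,0), (1,1,1), (1,1,-1)]),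
      (5, 1, [(1,0,0), (1,0,0), (0,1,0), (1,0,0), (1,1,0)]),
      (6, 1, [(1,0,0), (1,0,0), (0,1,0), (1,0,1), (1,1,-1)])]),
    ([(1,0), (2,0), (3,0), (5,0)],
     [(3,0), (4,0), (5,0), (6,0)],
     [(1, 1, [(1,0,0), (0,1,0), (1,0,1), (1,1,-1), (1,0,0)]),
      (2, 1, [(1,1,0), (1,0,0), (0,1,0), (1,0,1), (0,1,1)]),
      (3, 1, [(1,0,0), (0,1,0), (1,1,1), (1,1,1), (1,1,-1)]),
      (4, 1, [(1,1,0), (0,0,1), (1,0,0), (1,0,1), (0,1,1)]),
      (5, 1, [(1,1,0), (1,-1,1), (0,1,1), (1,0,0), (1,0,0)]),
      (6, 1, [(1,0,0), (0,1,1), (1,1,-1), (1,0,1), (1,-1,-1)])]),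
    ([(1,0), (2,0), (3,0), (4,0)],
     [(3,0), (4,0), (5,0), (6,0)],
     [(1, 1, [(1,0,0), (0,1,1), (1,1,-1), (1,0,1), (1,-1,-1)]),
      (2, 1, [(1,1,0), (1,0,1), (0,1,0), (1,0,0), (0,1,1)]),
      (3, 1, [(1,0,0), (0,1,1), (1,1,0), (1,-1,-1), (1,0,1)]),
      (4, 1, [(1,0,0), (0,1,0), (1,0,0), (1,1,1), (1,1,1)]),
      (5, 1, [(1,1,0), (0,0,1), (1,0,0), (0,1,1), (1,0,1)]),
      (6, 1, [(1,0,0), (0,1,1), (1,1,-1), (1,0,1), (1,-1,-1)])]),
    ([(1,0), (2,0), (3,0), (4,0)],
     [(3,0), (4,0), (5,0), (6,0)],
     [(1, 1, [(1,1,0), (0,0,1), (1,0,0), (0,1,1), (1,0,1)]),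
      (2, 1, [(1,0,0), (1,1,0), (1,-1,1), (1,0,-1), (1,0,0)]),
      (3, 1, [(1,0,0), (0,1,0), (1,1,1), (1,1,1), (1,1,-1)]),
      (4, 1, [(1,0,0), (0,1,0), (1,0,0), (1,1,1), (1,1,-1)]),
      (5, 1, [(1,1,0), (0,0,1), (1,0,0), (0,1,1), (1,0,1)]),
      (6, 1, [(1,0,0), (0,1,1), (1,1,-1), (1,0,1), (1,-1,-1)])]),
    ([(1,0), (2,0), (3,0), (5,0)],
     [(2,0), (3,0), (4,0), (5,1)],
     [(1, 1, [(1,0,0), (0,1,0), (1,0,0), (1,1,1), (1,1,-1)]),
      (2, 1, [(1,0,0), (1,1,0), (1,-1,0), (1,0,0), (1,0,0)]),
      (3, 1, [(1,1,0), (1,-1,0), (1,0,0), (1,0,0), (1,0,0)]),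
      (4, 1, [(1,0,0), (0,1,0), (1,0,0), (1,1,1), (1,1,-1)]),
      (5, 1, [(1,1,0), (0,0,1), (1,0,0), (0,1,1), (1,0,1)])]),
    ([(1,0), (2,0), (3,0), (7,0)],
     [(1,1), (2,1), (3,1), (7,0)],
     [(1, 1, [(1,1,1), (1,0,-1), (1,-1,0), (1,1,1), (1,1,1), (1,0,0)]),
      (2, 1, [(1,1,0), (1,0,1), (1,-1,-1), (1,-1,-1), (1,-1,-1), (1,0,0)]),
      (3, 1, [(1,0,0), (1,0,0), (0,1,0), (0,1,0), (0,0,1), (1,1,1)]),
      (7, 1, [(1,0,0), (1,0,0), (0,1,0), (0,1,0), (0,0,0), (0,0,0)])]),
    ([(1,0), (2,0), (4,0), (6,0)],
     [(1,1), (2,1), (6,0), (7,0)],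
     [(1, 1, [(1,1,1), (1,1,1), (1,1,1), (1,0,-1), (0,1,0), (1,0,0)]),
      (2, 1, [(1,0,0), (1,0,0), (0,1,1), (0,1,-1), (1,-1,-1), (1,1,0)]),
      (4, 1, [(1,0,0), (1,0,0), (0,1,0), (0,0,1), (1,1,1), (1,1,1)]),
      (6, 1, [(1,1,0), (1,0,1), (1,-1,-1), (1,-1,-1), (1,-1,-1), (1,0,0)]),
      (7, 1, [(1,0,0), (1,0,0), (0,1,0), (0,0,1), (0,0,0), (1,1,1)])]),
    ([(2,0), (3,0), (4,0), (7,0)],
     [(2,1), (4,1), (6,0), (7,0)],
     [(2, 1, [(1,0,0), (0,1,0), (1,0,1), (1,0,-1), (1,0,0), (1,1,0)]),
      (3, 1, [(1,1,0), (1,-1,0), (1,0,1), (1,0,-1), (1,0,0), (1,0,0)]),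
      (4, 1, [(1,1,0), (1,-1,0), (0,0,1), (1,0,0), (1,0,0), (1,0,1)]),
      (6, 1, [(1,1,1), (1,1,1), (1,0,-1), (1,-1,1), (1,-1,1), (1,0,0)]),
      (7, 1, [(1,0,0), (0,1,0), (0,0,0), (1,1,1), (1,1,1), (1,1,-1)])]),
    ([(1,0), (3,0), (5,0), (7,0)],
     [(1,1), (5,1), (6,0), (7,0)],
     [(1, 1, [(1,0,0), (0,1,0), (1,0,0), (1,0,0), (1,0,1), (1,1,-1)]),
      (3, 1, [(1,1,0), (1,-1,0), (1,0,0), (1,0,0), (1,0,1), (1,0,-1)]),
      (5, 1, [(1,1,1), (1,1,1), (1,0,-1), (-1,0,-1), (1,-1,1), (0,-1,-1)]),
      (6, 1, [(1,1,0), (1,-1,0), (0,0,1), (1,0,0), (1,0,0), (1,0,1)]),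
      (7, 1, [(1,1,0), (1,-1,0), (0,0,0), (1,0,0), (1,0,0), (1,0,0)])]),
    ([(2,0), (3,0), (4,0), (6,0)],
     [(2,1), (3,0), (5,0), (7,0)],
     [(2, 1, [(1,0,0), (0,1,1), (1,0,0), (1,1,-1), (1,0,1), (1,-1,-1)]),
      (3, 1, [(1,1,1), (1,1,1), (0,-1,-1), (-1,0,-1), (-1,1,1), (-1,-1,0)]),
      (4, 1, [(1,1,1), (1,1,1), (1,0,-1), (1,-1,1), (0,-1,-1), (1,0,0)]),
      (5, 1, [(1,1,1), (1,1,1), (1,0,-1), (0,1,0), (-1,1,1), (-1,1,1)]),
      (6, 1, [(1,1,0), (1,-1,0), (0,0,1), (1,0,0), (1,0,0), (1,0,1)]),
      (7, 1, [(1,1,1), (1,1,1), (1,0,-1), (-1,0,-1), (1,-1,1), (0,-1,-1)])]),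
    ([(1,0), (3,0), (4,0), (6,0)],
     [(1,1), (3,0), (4,1), (6,1)],
     [(1, 1, [(1,0,0), (0,1,0), (1,0,0), (1,0,0), (1,1,1), (1,1,-1)]),
      (3, 1, [(1,1,0), (1,-1,0), (1,0,0), (1,0,0), (1,0,0), (1,0,0)]),
      (4, 1, [(1,1,1), (1,1,1), (1,0,-1), (1,-1,1), (1,0,0), (1,0,0)]),
      (6, 1, [(1,1,0), (1,-1,0), (0,0,1), (1,0,0), (1,0,0), (1,0,1)])]),
    ([(1,0), (2,0), (3,0), (4,0)],
     [(1,1), (2,0), (4,1), (5,0)],
     [(1, 1, [(1,1,1), (1,1,1), (1,0,-1), (0,1,0), (0,1,0), (1,0,0)]),
      (2, -1, [(1,0,0), (1,0,0), (0,1,1), (1,-1,-1), (1,-1,-1), (1,1,0)]),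
      (3, 1, [(1,0,0), (1,0,0), (0,1,1), (1,1,0), (1,0,1), (1,-1,-1)]),
      (4, 1, [(1,0,0), (1,0,0), (0,1,1), (0,1,-1), (1,-1,-1), (1,1,0)]),
      (5, 1, [(1,0,0), (1,0,0), (0,1,0), (0,0,0), (1,1,1), (1,1,-1)])]),
    ([(2,0), (3,0), (4,0), (5,0)],
     [(2,1), (4,1), (5,0), (7,0)],
     [(2, -1, [(1,0,0), (0,1,1), (1,-1,-1), (1,-1,-1), (1,1,0), (1,0,0)]),
      (3, 1, [(1,1,1), (1,1,1), (1,0,0), (1,0,0), (0,1,0), (1,1,-1)]),
      (4, 1, [(1,1,1), (1,1,1), (1,0,-1), (1,-1,1), (0,-1,-1), (-1,0,-1)]),
      (5, 1, [(1,1,0), (1,-1,0), (0,0,0), (1,0,0), (1,0,0), (1,0,0)]),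
      (7, 1, [(1,1,1), (1,1,1), (1,0,-1), (0,1,0), (0,1,0), (1,0,0)])]),
    ([(2,0), (3,0), (4,0), (5,0)],
     [(2,1), (4,0), (5,1), (6,0)],
     [(2, 1, [(1,1,0), (1,-1,1), (0,1,1), (1,0,0), (1,0,0), (0,1,-1)]),
      (3, 1, [(1,0,0), (0,1,1), (1,-1,-1), (1,1,0), (1,0,1), (1,-1,-1)]),
      (4, 1, [(1,1,0), (1,-1,1), (1,-1,1), (1,0,0), (1,0,0), (0,1,-1)]),
      (5, 1, [(1,1,1), (1,1,1), (1,0,-1), (-1,0,-1), (-1,1,1), (-1,1,1)]),
      (6, 1, [(1,1,1), (1,1,1), (1,0,-1), (0,1,0), (1,0,0), (1,0,0)])]),
    ([(1,0), (3,0), (4,0), (5,0)],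
     [(1,1), (4,0), (5,1), (7,0)],
     [(1, 1, [(1,1,0), (1,-1,1), (0,1,1), (-1,-1,1), (-1,-1,1), (0,1,-1)]),
      (3, 1, [(1,1,1), (1,1,1), (0,-1,-1), (1,1,-1), (1,1,-1), (1,0,0)]),
      (4, 1, [(1,1,0), (1,-1,1), (1,-1,1), (-1,-1,1), (-1,-1,1), (0,1,-1)]),
      (5, 1, [(1,1,1), (1,1,1), (1,0,-1), (0,1,0), (1,0,0), (1,0,0)]),
      (7, 1, [(1,1,1), (1,1,1), (1,0,-1), (-1,0,-1), (-1,1,1), (-1,1,1)])]),
    ([(1,0), (3,0), (4,0), (7,0)],
     [(1,1), (4,0), (6,0), (7,1)],
     [(1, 1, [(1,0,0), (0,1,1), (1,0,0), (1,-1,-1), (1,1,0), (1,0,1)]),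
      (3, 1, [(1,1,1), (1,1,1), (0,-1,-1), (-1,1,1), (-1,0,-1), (-1,-1,0)]),
      (4, 1, [(1,1,0), (1,-1,1), (1,-1,1), (0,1,-1), (1,0,0), (1,0,0)]),
      (6, 1, [(1,1,1), (1,1,1), (1,0,-1), (1,-1,1), (1,0,0), (1,0,0)]),
      (7, 1, [(1,1,1), (1,1,1), (1,0,-1), (0,1,0), (-1,1,1), (-1,1,1)])]),
    ([(2,0), (3,0), (4,0), (5,0)],
     [(2,1), (4,0), (5,1), (7,0)],
     [(2, 1, [(1,0,0), (0,1,0), (1,0,0), (1,1,1), (1,1,1), (1,1,-1)]),
      (3, 1, [(1,1,0), (1,-1,0), (1,0,0), (1,0,1), (1,0,-1), (1,0,0)]),
      (4, 1, [(1,1,0), (1,-1,1), (1,-1,1), (-1,-1,1), (-1,-1,1), (0,1,-1)]),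
      (5, 1, [(1,1,1), (1,1,1), (1,0,-1), (1,-1,1), (1,0,0), (1,0,0)]),
      (7, 1, [(1,1,1), (1,1,1), (1,0,-1), (0,1,0), (-1,1,1), (-1,1,1)])]),
    ([(1,0), (3,0), (5,0), (7,0)],
     [(1,1), (5,1), (6,0), (7,0)],
     [(1, 1, [(1,0,0), (0,1,1), (1,-1,-1), (1,-1,-1), (1,1,0), (1,-1,1)]),
      (3, 1, [(1,1,1), (1,1,1), (1,1,-1), (1,1,-1), (0,-1,-1), (1,0,0)]),
      (5, 1, [(1,1,1), (1,1,1), (1,0,-1), (1,0,0), (0,-1,-1), (1,-1,1)]),
      (6, 1, [(1,1,1), (1,1,1), (1,0,-1), (-1,1,1), (-1,1,1), (0,1,0)]),
      (7, 1, [(1,0,0), (0,1,0), (0,0,1), (1,1,1), (1,1,1), (1,1,1)])]),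
    ([(1,0), (2,0), (5,0), (7,0)],
     [(1,0), (2,1), (5,1), (7,1)],
     [(1, 1, [(1,0,0), (1,0,0), (0,1,0), (0,1,0), (1,0,0), (1,0,0)]),
      (2, 1, [(1,1,1), (1,0,-1), (0,1,0), (0,1,0), (1,0,0), (1,0,0)]),
      (5, -1, [(1,0,0), (0,1,0), (0,1,0), (1,0,1), (1,1,1), (1,1,1)]),
      (7, 1, [(1,1,0), (0,0,1), (0,0,1), (1,0,0), (1,0,0), (0,1,1)])]),
    ([(1,0), (2,0), (4,0), (7,0)],
     [(1,1), (2,0), (5,0), (7,1)],
     [(1, 1, [(1,1,1), (1,0,-1), (1,-1,1), (0,-1,-1), (1,0,0), (1,0,0)]),
      (2, 1, [(1,1,0), (1,0,1), (1,0,0), (0,1,1), (1,0,0), (1,0,0)]),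
      (4, 1, [(1,0,0), (1,0,0), (0,1,1), (1,-1,-1), (1,1,0), (1,0,1)]),
      (5, 1, [(1,0,0), (1,0,0), (0,1,0), (1,0,0), (1,1,1), (1,1,-1)]),
      (7, 1, [(1,0,0), (1,0,0), (0,1,1), (1,1,-1), (1,0,1), (1,-1,-1)])]),
    ([(1,0), (2,0), (3,0), (4,0)],
     [(1,1), (2,0), (3,1), (7,0)],
     [(1, 1, [(1,1,1), (1,1,1), (1,0,0), (1,0,0), (0,1,0), (1,1,-1)]),
      (2, 1, [(1,0,0), (1,0,0), (1,1,0), (1,0,1), (1,-1,-1), (1,0,0)]),
      (3, 1, [(1,0,0), (1,0,0), (0,1,0), (1,1,1), (1,1,1), (1,1,-1)]),
      (4, 1, [(1,1,0), (1,0,1), (1,-1,-1), (1,0,0), (1,0,0), (1,0,0)]),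
      (7, 1, [(1,0,0), (1,0,0), (0,1,1), (1,1,0), (1,0,1), (1,-1,-1)])]),
    ([(1,0), (3,0), (4,0), (6,0)],
     [(2,0), (3,1), (4,0), (6,1)],
     [(1, 1, [(1,0,0), (1,1,0), (1,0,1), (1,-1,-1), (1,0,0), (1,0,0)]),
      (2, 1, [(1,0,0), (1,1,0), (1,0,1), (1,-1,-1), (1,0,0), (1,0,0)]),
      (3, 1, [(1,1,0), (1,-1,0), (1,0,1), (1,0,-1), (1,0,0), (1,0,0)]),
      (4, 1, [(1,1,0), (1,-1,0), (1,0,0), (1,0,0), (1,0,0), (1,0,0)]),
      (6, 1, [(1,1,1), (1,1,1), (1,0,0), (1,0,0), (0,1,0), (1,1,-1)])]),
    ([(3,0), (4,0), (5,0), (6,0)],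
     [(4,1), (5,1), (6,1), (7,0)],
     [(3, -1, [(1,0,0), (1,0,0), (0,1,0), (0,1,0), (1,1,1), (1,1,1), (1,1,-1)]),
      (4, 1, [(1,1,1), (1,1,1), (1,0,-1), (1,-1,0), (1,0,0), (1,0,0), (0,-1,-1)]),
      (5, 1, [(1,1,1), (1,0,-1), (1,-1,0), (1,1,1), (1,0,0), (1,0,0), (0,-1,-1)]),
      (6, 1, [(1,0,0), (0,1,0), (0,1,0), (0,0,1), (0,0,1), (1,1,1), (1,1,1)]),
      (7, -1, [(0,0,1), (1,0,0), (1,0,0), (0,1,0), (0,1,0), (1,1,-1), (1,1,-1)])]),
    ([(1,0), (3,0), (5,0), (6,0)],
     [(1,1), (5,1), (6,1), (8,0)],
     [(1, 1, [(1,1,1), (1,1,1), (1,0,-1), (1,-1,0), (-1,1,1), (-1,1,1), (0,-1,-1)]),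
      (3, 1, [(1,0,0), (1,0,0), (0,1,0), (0,1,0), (1,1,1), (1,1,1), (1,1,-1)]),
      (5, 1, [(1,1,0), (1,0,1), (1,-1,-1), (1,-1,-1), (-1,-1,-1), (-1,-1,-1), (0,1,1)]),
      (6, -1, [(1,0,0), (1,0,0), (0,0,1), (0,1,0), (0,1,0), (1,1,-1), (1,1,-1)]),
      (8, 1, [(1,0,0), (1,0,0), (0,1,0), (0,0,1), (0,0,1), (1,1,1), (1,1,1)])]),
    ([(3,0), (4,0), (5,0), (7,0)],
     [(3,1), (4,1), (5,1), (7,1)],
     [(3, 1, [(1,1,0), (0,0,1), (0,0,1), (1,0,1), (0,1,1), (-1,-1,1), (-1,-1,1)]),
      (4, 1, [(1,1,1), (1,1,1), (1,1,1), (1,0,0), (1,0,0), (0,1,0), (0,0,1)]),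
      (5, 1, [(1,0,0), (0,1,0), (0,0,1), (0,0,1), (1,1,1), (1,1,1), (1,1,1)]),
      (7, 1, [(1,1,1), (1,1,1), (1,0,-1), (1,-1,0), (1,0,0), (1,0,0), (0,-1,-1)])]),
    ([(1,0), (3,0), (5,0), (7,0)],
     [(1,1), (3,1), (5,1), (7,1)],
     [(1, 1, [(1,0,0), (1,1,0), (1,-1,0), (1,0,1), (1,0,-1), (1,0,0), (1,0,0)]),
      (3, 1, [(1,1,0), (1,-1,0), (1,0,0), (1,0,1), (1,0,-1), (1,0,0), (1,0,0)]),
      (5, 1, [(1,1,0), (1,-1,0), (1,0,1), (1,0,-1), (1,0,0), (1,0,0), (1,0,0)]),
      (7, -1, [(1,0,1), (1,0,1), (0,1,-1), (0,1,-1), (0,-1,-1), (0,-1,-1), (-1,0,1)])])]"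

text \<open>A finite computation: each entry is checked against the witness at the same
  position.\<close>

lemma certifies_F3: "list_all2 certifies F3_entries F3_witnesses"
  by code_simp

theorem proposition3p1:
  fixes G :: "(nat \<times> nat) mgraph"
  assumes "G \<in> F3"
  shows "G \<in> Forb_Gamma 3"
proof -
  obtain e where e: "e \<in> set F3_entries" "G = entry_graph e"
    using assms by (auto simp: F3_def)
  then obtain c where "certifies e c"
    using certifies_F3 by (metis list_all2_conv_all_nth in_set_conv_nth)
  with e show ?thesis
    by (simp add: Forb_Gamma_if_certifies)
qed

end
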